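(* Suppose that $\alpha=(\{D_g\}_{g\in G},\{\alpha_g\}_{g\in G})$ is a partial action of a hypercentral group $G$, with neutral element $e$, on a ring $A$ such that for each $g\in G$ the ring $D_g$ has local units. Let $E$ denote a set of local units for $A$. The following three assertions are equivalent: (i) $A\star_\alpha G$ is a simple ring; (ii) $A$ is $G$-simple and the center of the corner subring $f\delta_e\,(A\star_\alpha G)\,f\delta_e$ is a field, for some non-zero $f\in E$; (iii) $A$ is $G$-simple and the center of the corner subring $f\delta_e\,(A\star_\alpha G)\,f\delta_e$ is a field, for each non-zero $f\in E$.
   Context: The ring $A$ is associative and not necessarily unital. Ideals are two-sided. A ring is simple if the ring itself and $\{0\}$ are its only ideals. A group is hypercentral if each of its non-trivial factor groups has non-trivial center. A ring $R$ has local units if there is a set $E$ of idempotents in $R$ such that for every finite subset $X$ of $R$ there is $f\in E$ with $X\subseteq fRf$ (so $x=fx=xf$ for all $x\in X$). Such an $E$ is called a set of local units for $R$. A partial action $\alpha$ of a group $G$ (with neutral element $e$) on a ring $A$ is a collection of ideals $\{D_g\}_{g\in G}$ of $A$ and a collection of ring isomorphisms $\alpha_g:D_{g^{-1}}\to D_g$ such that for all $g,h\in G$ and every $x\in D_{h^{-1}}\cap D_{(gh)^{-1}}$: (i) $\alpha_e=\mathrm{id}_A$ (in particular $D_e=A$); (ii) $\alpha_g(D_{g^{-1}}\cap D_h)=D_g\cap D_{gh}$; (iii) $\alpha_g(\alpha_h(x))=\alpha_{gh}(x)$. The partial skew group ring $A\star_\alpha G$ is the set of all finite formal sums $\sum_{g\in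 G}a_g\delta_g$, where $a_g\in D_g$ for each $g\in G$ and $\delta_g$ is a symbol, with the obvious addition and with multiplication the linear extension of $(a_g\delta_g)(b_h\delta_h)=\alpha_g(\alpha_{g^{-1}}(a_g)b_h)\delta_{gh}$ for $g,h\in G$, $a_g\in D_g$, $b_h\in D_h$. When every $D_g$ has local units, this multiplication is known to be associative. An ideal $I$ of $A$ is $G$-invariant if $\alpha_g(I\cap D_{g^{-1}})\subseteq I$ for each $g\in G$. The ring $A$ is $G$-simple if $A$ and $\{0\}$ are the only $G$-invariant ideals of $A$. *)

theory Defs
  imports "HOL-Algebra.QuotRing"
begin

definition center :: "('a, 'm) monoid_scheme \<Rightarrow> 'a set"
  where "center M = {z \<in> carrier M. \<forall>x \<in> carrier M. z \<otimes>\<^bsub>M\<^esub> x = x \<otimes>\<^bsub>M\<^esub> z}"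

definition hypercentral :: "('g, 'm) monoid_scheme \<Rightarrow> bool"
  where "hypercentral G \<longleftrightarrow> group G \<and>
    (\<forall>N. N \<lhd> G \<and> carrier (G Mod N) \<noteq> {\<one>\<^bsub>G Mod N\<^esub>} \<longrightarrow> center (G Mod N) \<noteq> {\<one>\<^bsub>G Mod N\<^esub>})"

text \<open>The library's rings are unital. We reuse its ring records for rings that need not have
  a unit; in a structure satisfying only \<open>rng\<close>, the field \<open>\<one>\<close> of the record has no meaning.\<close>

locale rng = abelian_group R for R (structure) +
  assumes rng_m_closed: "\<lbrakk>x \<in> carrier R; y \<in> carrier R\<rbrakk> \<Longrightarrow> x \<otimes> y \<in> carrier R"
    and rng_m_assoc: "\<lbrakk>x \<in> carrier R; y \<in> carrier R; z \<in> carrier R\<rbrakk>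
      \<Longrightarrow> (x \<otimes> y) \<otimes> z = x \<otimes> (y \<otimes> z)"
    and rng_l_distr: "\<lbrakk>x \<in> carrier R; y \<in> carrier R; z \<in> carrier R\<rbrakk>
      \<Longrightarrow> (x \<oplus> y) \<otimes> z = x \<otimes> z \<oplus> y \<otimes> z"
    and rng_r_distr: "\<lbrakk>x \<in> carrier R; y \<in> carrier R; z \<in> carrier R\<rbrakk>
      \<Longrightarrow> z \<otimes> (x \<oplus> y) = z \<otimes> x \<oplus> z \<otimes> y"

locale rng_ideal = additive_subgroup I R + rng R for I and R (structure) +
  assumes rng_I_l_closed: "\<lbrakk>a \<in> I; x \<in> carrier R\<rbrakk> \<Longrightarrow> x \<otimes> a \<in> I"
    and rng_I_r_closed: "\<lbrakk>a \<in> I; x \<in> carrier R\<rbrakk> \<Longrightarrow> a \<otimes> x \<in> I"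

text \<open>As usual, the zero ring does not count as simple: the two ideals have to be distinct.\<close>

locale simple_rng = rng +
  assumes simple_nontrivial: "carrier R \<noteq> {\<zero>}"
    and simple_ideals: "rng_ideal I R \<Longrightarrow> I = carrier R \<or> I = {\<zero>}"

text \<open>Isomorphisms of rings without unit: the library's \<open>ring_iso\<close> also requires
  that the units correspond.\<close>

definition rng_iso :: "('a, 'm) ring_scheme \<Rightarrow> ('b, 'n) ring_scheme \<Rightarrow> ('a \<Rightarrow> 'b) set"
  where "rng_iso R S = iso R S \<inter> iso (add_monoid R) (add_monoid S)"

definition corner_set :: "('a, 'm) ring_scheme \<Rightarrow> 'a \<Rightarrow> 'a set"
  where "corner_set R f = {f \<otimes>\<^bsub>R\<^esub> x \<otimes>\<^bsub>R\<^esub> f | x. x \<in> carrier R}"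

text \<open>For an idempotent \<open>f\<close>, the corner \<open>f R f\<close> is a unital ring with unit \<open>f\<close>.\<close>

definition corner :: "('a, 'm) ring_scheme \<Rightarrow> 'a \<Rightarrow> ('a, 'm) ring_scheme"
  where "corner R f = R\<lparr>carrier := corner_set R f, one := f\<rparr>"

definition center_ring :: "('a, 'm) ring_scheme \<Rightarrow> ('a, 'm) ring_scheme"
  where "center_ring R = R\<lparr>carrier := center R\<rparr>"

definition set_of_local_units :: "('a, 'm) ring_scheme \<Rightarrow> 'a set \<Rightarrow> bool"
  where "set_of_local_units R E \<longleftrightarrow>
    E \<subseteq> {f \<in> carrier R. f \<otimes>\<^bsub>R\<^esub> f = f} \<and>
    (\<forall>F. finite F \<and> F \<subseteq> carrier R \<longrightarrow> (\<exists>f \<in> E. F \<subseteq> corner_set R f))"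

definition has_local_units :: "('a, 'm) ring_scheme \<Rightarrow> bool"
  where "has_local_units R \<longleftrightarrow> (\<exists>E. set_of_local_units R E)"

locale partial_action = group G + A?: rng A
  for G :: "('g, 'm) monoid_scheme" (structure)
    and A :: "('a, 'n) ring_scheme"
    and D :: "'g \<Rightarrow> 'a set"
    and \<alpha> :: "'g \<Rightarrow> 'a \<Rightarrow> 'a" +
  assumes D_ideal: "g \<in> carrier G \<Longrightarrow> rng_ideal (D g) A"
    and \<alpha>_iso: "g \<in> carrier G \<Longrightarrow> \<alpha> g \<in> rng_iso (A\<lparr>carrier := D (inv g)\<rparr>) (A\<lparr>carrier := D g\<rparr>)"
    and D_one: "D \<one> = carrier A"
    and \<alpha>_one: "x \<in> carrier A \<Longrightarrow> \<alpha> \<one> x = x"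
    and \<alpha>_image: "\<lbrakk>g \<in> carrier G; h \<in> carrier G\<rbrakk>
      \<Longrightarrow> \<alpha> g ` (D (inv g) \<inter> D h) = D g \<inter> D (g \<otimes> h)"
    and \<alpha>_comp: "\<lbrakk>g \<in> carrier G; h \<in> carrier G; x \<in> D (inv h) \<inter> D (inv (g \<otimes> h))\<rbrakk>
      \<Longrightarrow> \<alpha> g (\<alpha> h x) = \<alpha> (g \<otimes> h) x"

definition G_invariant :: "('g, 'm) monoid_scheme \<Rightarrow> ('g \<Rightarrow> 'a set) \<Rightarrow> ('g \<Rightarrow> 'a \<Rightarrow> 'a) \<Rightarrow> 'a set \<Rightarrow> bool"
  where "G_invariant G D \<alpha> I \<longleftrightarrow> (\<forall>g \<in> carrier G. \<alpha> g ` (I \<inter> D (inv\<^bsub>G\<^esub> g)) \<subseteq> I)"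

text \<open>The zero ring is excluded here for the same reason as in \<open>simple_rng\<close>.\<close>

definition G_simple ::
    "('g, 'm) monoid_scheme \<Rightarrow> ('a, 'n) ring_scheme \<Rightarrow> ('g \<Rightarrow> 'a set) \<Rightarrow> ('g \<Rightarrow> 'a \<Rightarrow> 'a) \<Rightarrow> bool"
  where "G_simple G A D \<alpha> \<longleftrightarrow> carrier A \<noteq> {\<zero>\<^bsub>A\<^esub>} \<and>
    (\<forall>I. rng_ideal I A \<and> G_invariant G D \<alpha> I \<longrightarrow> I = carrier A \<or> I = {\<zero>\<^bsub>A\<^esub>})"

text \<open>A formal sum \<open>\<Sum>g. a\<^sub>g \<delta>\<^sub>g\<close> is represented by its coefficient function, which is finitely
  supported and \<open>undefined\<close> outside \<open>carrier G\<close>. The coefficient of a product at \<open>k\<close> collects the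
  terms \<open>(a\<^sub>g \<delta>\<^sub>g) (b\<^sub>h \<delta>\<^sub>h)\<close> with \<open>gh = k\<close>.\<close>

definition supp :: "('g, 'm) monoid_scheme \<Rightarrow> ('a, 'n) ring_scheme \<Rightarrow> ('g \<Rightarrow> 'a) \<Rightarrow> 'g set"
  where "supp G A a = {g \<in> carrier G. a g \<noteq> \<zero>\<^bsub>A\<^esub>}"

definition skew_group_ring ::
    "('g, 'm) monoid_scheme \<Rightarrow> ('a, 'n) ring_scheme \<Rightarrow> ('g \<Rightarrow> 'a set) \<Rightarrow> ('g \<Rightarrow> 'a \<Rightarrow> 'a) \<Rightarrow> ('g \<Rightarrow> 'a) ring"
  where "skew_group_ring G A D \<alpha> =
   \<lparr>carrier = {a \<in> (\<Pi>\<^sub>E g \<in> carrier G. D g). finite (supp G A a)},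
    mult = (\<lambda>a b. \<lambda>k \<in> carrier G.
      finsum A (\<lambda>(g, h). \<alpha> g (\<alpha> (inv\<^bsub>G\<^esub> g) (a g) \<otimes>\<^bsub>A\<^esub> b h))
        {(g, h). g \<in> supp G A a \<and> h \<in> supp G A b \<and> g \<otimes>\<^bsub>G\<^esub> h = k}),
    one = undefined,
    zero = (\<lambda>g \<in> carrier G. \<zero>\<^bsub>A\<^esub>),
    add = (\<lambda>a b. \<lambda>g \<in> carrier G. a g \<oplus>\<^bsub>A\<^esub> b g)\<rparr>"

text \<open>The element \<open>a \<delta>\<^sub>g\<close>.\<close>

definition skew_monom ::
    "('g, 'm) monoid_scheme \<Rightarrow> ('a, 'n) ring_scheme \<Rightarrow> 'a \<Rightarrow> 'g \<Rightarrow> 'g \<Rightarrow> 'a"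
  where "skew_monom G A a g = (\<lambda>k \<in> carrier G. if k = g then a else \<zero>\<^bsub>A\<^esub>)"

end

theory Submission
  imports Defs
begin

text \<open>
  Grade \<open>S = A \<star> G\<close> by the cosets of a normal subgroup \<open>N\<close>. If \<open>A\<close> is \<open>G\<close>-simple, then \<open>S\<close> is graded
  simple for \<open>N = 1\<close>; simplicity of \<open>S\<close> is graded simplicity for \<open>N = G\<close>. Graded simplicity passes to
  unions of chains because supports are finite, so Zorn's lemma yields a maximal \<open>N\<close> for which it holds.
  If \<open>N \<noteq> G\<close>, let \<open>Z \<supset> N\<close> be the preimage of the center of \<open>G/N\<close>, and in an ideal \<open>I\<close> choose a nonzero
  \<open>Z\<close>-homogeneous \<open>x\<close> whose support meets as few \<open>N\<close>-cosets as possible. As one \<open>N\<close>-component of \<open>x\<close>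
  generates \<open>S\<close>, and \<open>Z/N\<close> is central in \<open>G/N\<close>, multiplying \<open>x\<close> from both sides and adding up gives
  \<open>y \<in> I\<close> in the corner of \<open>\<phi> = f \<delta>\<^sub>e\<close> with no more \<open>N\<close>-cosets and with \<open>N\<close>-component \<open>\<phi>\<close>.
  Commutators of \<open>y\<close> with homogeneous elements of the corner have fewer cosets, hence vanish. So \<open>y\<close> is a
  nonzero central element of the corner, and it is invertible there if the center is a field; then
  \<open>\<phi> \<in> I\<close> and \<open>I = S\<close>. Thus \<open>S\<close> is graded simple for \<open>Z\<close>, contradicting the choice of \<open>N\<close>.

  Conversely, a \<open>G\<close>-invariant ideal of \<open>A\<close> extends to an ideal of \<open>S\<close>. For a nonzero central \<open>z\<close> of a
  corner \<open>f R f\<close> of a simple ring \<open>R\<close>, the \<open>x\<close> with \<open>f R x R f \<subseteq> z f R f\<close> form an ideal containing \<open>z\<close>, so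
  \<open>f\<close> lies in it and \<open>z\<close> is invertible.
\<close>

subsection \<open>Rings without unit\<close>

lemma (in additive_subgroup) finsum_closed_subgroup:
  assumes "abelian_group G" "finite F" "f \<in> F \<rightarrow> H"
  shows "finsum G f F \<in> H"
  using assms(2,3)
proof (induction F rule: finite_induct)
  interpret abelian_group G by fact
  case empty
  then show ?case by simp
next
  interpret abelian_group G by fact
  case (insert x F)
  then have "f \<in> F \<rightarrow> carrier G" "f x \<in> carrier G" using a_subset by auto
  with insert show ?case by simp
qed

context rng
begin

lemma rng_zero_left [simp]: "x \<in> carrier R \<Longrightarrow> \<zero> \<otimes> x = \<zero>"
  by (metis add.r_cancel_one' rng_l_distr rng_m_closed zero_closed l_zero)

lemma rng_zero_right [simp]: "x \<in> carrier R \<Longrightarrow> x \<otimes> \<zero> = \<zero>"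
  by (metis add.r_cancel_one' rng_r_distr rng_m_closed zero_closed l_zero)

lemma rng_minus_zero [simp]: "\<ominus> \<zero> = \<zero>"
  using minus_equality[of \<zero> \<zero>] by simp

lemma rng_l_minus: "x \<in> carrier R \<Longrightarrow> y \<in> carrier R \<Longrightarrow> \<ominus> x \<otimes> y = \<ominus> (x \<otimes> y)"
  by (metis a_inv_closed l_neg minus_equality rng_l_distr rng_m_closed rng_zero_left)

lemma rng_r_minus: "x \<in> carrier R \<Longrightarrow> y \<in> carrier R \<Longrightarrow> x \<otimes> \<ominus> y = \<ominus> (x \<otimes> y)"
  by (metis a_inv_closed l_neg minus_equality rng_r_distr rng_m_closed rng_zero_right)

lemma rng_idealI:
  assumes "I \<subseteq> carrier R" "\<zero> \<in> I"
    and "\<And>x y. \<lbrakk>x \<in> I; y \<in> I\<rbrakk> \<Longrightarrow> x \<oplus> y \<in> I"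
    and "\<And>a x. \<lbrakk>a \<in> I; x \<in> carrier R\<rbrakk> \<Longrightarrow> x \<otimes> a \<in> I"
    and "\<And>a x. \<lbrakk>a \<in> I; x \<in> carrier R\<rbrakk> \<Longrightarrow> a \<otimes> x \<in> I"
    and "\<And>x. x \<in> I \<Longrightarrow> \<ominus> x \<in> I"
  shows "rng_ideal I R"
proof -
  have "subgroup I (add_monoid R)"
    using assms by unfold_locales (auto simp: a_inv_def)
  then show ?thesis
    by (intro rng_ideal.intro rng_ideal_axioms.intro additive_subgroupI)
      (use assms rng_axioms in auto)
qed

section \<open>Corners at an idempotent and their centers\<close>

lemma corner_set_fixed:
  assumes "f \<in> carrier R" "f \<otimes> f = f"
  shows "corner_set R f = {x \<in> carrier R. f \<otimes> x = x \<and> x \<otimes> f = x}"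
proof (intro equalityI subsetI)
  fix x assume "x \<in> corner_set R f"
  then obtain y where y: "y \<in> carrier R" "x = f \<otimes> y \<otimes> f" by (auto simp: corner_set_def)
  have "f \<otimes> (f \<otimes> (y \<otimes> f)) = f \<otimes> (y \<otimes> f)"
    using y assms by (metis rng_m_assoc rng_m_closed)
  then show "x \<in> {x \<in> carrier R. f \<otimes> x = x \<and> x \<otimes> f = x}"
    using y assms by (simp add: rng_m_closed rng_m_assoc)
next
  fix x assume "x \<in> {x \<in> carrier R. f \<otimes> x = x \<and> x \<otimes> f = x}"
  then show "x \<in> corner_set R f" unfolding corner_set_def by (metis (mono_tags, lifting) mem_Collect_eq)
qed

end

lemma (in rng_ideal) mem_carrier: "x \<in> I \<Longrightarrow> x \<in> carrier R"
  using a_subset by blast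

lemma (in simple_rng) field_center_corner:
  assumes f: "f \<in> carrier R" "f \<otimes> f = f" "f \<noteq> \<zero>"
  shows "field (center_ring (corner R f))"
proof -
  let ?C = "corner_set R f" and ?Z = "center_ring (corner R f)"
  have C_iff: "x \<in> ?C \<longleftrightarrow> x \<in> carrier R \<and> f \<otimes> x = x \<and> x \<otimes> f = x" for x
    using corner_set_fixed[OF f(1,2)] by auto
  have Z_iff: "z \<in> carrier ?Z \<longleftrightarrow> z \<in> ?C \<and> (\<forall>x\<in>?C. z \<otimes> x = x \<otimes> z)" for z
    by (simp add: center_ring_def corner_def center_def)
  have Z_simps [simp]: "mult ?Z = mult R" "one ?Z = f" "zero ?Z = \<zero>" "add ?Z = add R"
    by (simp_all add: center_ring_def corner_def)
  have cl: "x \<in> ?C \<Longrightarrow> x \<in> carrier R" for x using C_iff by blast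
  have Cm: "x \<in> ?C \<Longrightarrow> y \<in> ?C \<Longrightarrow> x \<otimes> y \<in> ?C" for x y
    using f by (auto simp: C_iff rng_m_closed rng_m_assoc) (metis rng_m_assoc)
  have Ca: "x \<in> ?C \<Longrightarrow> y \<in> ?C \<Longrightarrow> x \<oplus> y \<in> ?C" for x y
    using f by (auto simp: C_iff rng_l_distr rng_r_distr)
  have Cn: "x \<in> ?C \<Longrightarrow> \<ominus> x \<in> ?C" for x
    using f by (auto simp: C_iff rng_l_minus rng_r_minus)
  have C0: "\<zero> \<in> ?C" "f \<in> ?C" using f by (auto simp: C_iff)
  have fxf: "x \<in> carrier R \<Longrightarrow> f \<otimes> x \<otimes> f \<in> ?C" for x by (auto simp: corner_set_def)
  have Zn: "z \<in> carrier ?Z \<Longrightarrow> \<ominus> z \<in> carrier ?Z" for z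
    by (simp add: Z_iff Cn cl rng_l_minus rng_r_minus)
  have ab: "abelian_group ?Z"
  proof (rule abelian_groupI)
    fix x assume "x \<in> carrier ?Z"
    then show "\<exists>y\<in>carrier ?Z. y \<oplus>\<^bsub>?Z\<^esub> x = \<zero>\<^bsub>?Z\<^esub>"
      using Zn l_neg cl Z_iff by (metis Z_simps(3,4))
  qed (auto simp: Z_iff Ca C0 cl rng_l_distr rng_r_distr intro: a_assoc a_comm)
  have Zm: "x \<otimes> y \<in> carrier ?Z" if "x \<in> carrier ?Z" "y \<in> carrier ?Z" for x y
  proof -
    have "x \<otimes> y \<otimes> c = c \<otimes> (x \<otimes> y)" if "c \<in> ?C" for c
    proof -
      have c: "c \<in> carrier R" "x \<in> carrier R" "y \<in> carrier R" "x \<otimes> c = c \<otimes> x" "y \<otimes> c = c \<otimes> y"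
        using that \<open>x \<in> carrier ?Z\<close> \<open>y \<in> carrier ?Z\<close> cl by (auto simp: Z_iff)
      have "x \<otimes> y \<otimes> c = x \<otimes> c \<otimes> y" using rng_m_assoc[OF c(2,3,1)] rng_m_assoc[OF c(2,1,3)] c(5) by simp
      then show ?thesis using rng_m_assoc[OF c(1,2,3)] c(4) by simp
    qed
    moreover have "x \<otimes> y \<in> ?C" using that(1,2) Cm Z_iff by blast
    ultimately show ?thesis by (simp add: Z_iff)
  qed
  have ZC: "x \<in> carrier ?Z \<Longrightarrow> x \<in> carrier R" "x \<in> carrier ?Z \<Longrightarrow> f \<otimes> x = x"
    "x \<in> carrier ?Z \<Longrightarrow> y \<in> carrier ?Z \<Longrightarrow> x \<otimes> y = y \<otimes> x" for x y
    using Z_iff C_iff by blast+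
  have Zf: "f \<in> carrier ?Z" using Z_iff C_iff C0 by metis
  interpret Z: cring ?Z
  proof (rule cringI[OF ab])
    show "Group.comm_monoid ?Z"
      by (rule comm_monoidI) (simp_all add: Zm Zf ZC(1,2) rng_m_assoc, simp add: ZC(3))
  qed (simp add: ZC(1) rng_l_distr)
  show ?thesis
  proof (rule Z.cring_fieldI, intro equalityI subsetI)
    fix z assume "z \<in> Units ?Z"
    then obtain w where zw: "z \<in> carrier ?Z" "w \<in> carrier ?Z" "w \<otimes> z = f" by (auto simp: Units_def)
    have "z \<noteq> \<zero>" using zw ZC(1)[of w] f(3) by auto
    with zw show "z \<in> carrier ?Z - {\<zero>\<^bsub>?Z\<^esub>}" by simp
  next
    fix z assume "z \<in> carrier ?Z - {\<zero>\<^bsub>?Z\<^esub>}"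
    then have z: "z \<in> ?C" "\<And>x. x \<in> ?C \<Longrightarrow> z \<otimes> x = x \<otimes> z" "z \<noteq> \<zero>" "z \<in> carrier ?Z"
      using Z_iff unfolding Z_simps(3) by blast+
    note zc = cl[OF z(1)]
    \<comment> \<open>Testing \<open>f s x t f\<close> for arbitrary \<open>s\<close> and
      \<open>t\<close>, not just \<open>f x f\<close>, makes \<open>I\<close> absorb factors on both
      sides. The cofactor \<open>c\<close> is sought in the corner because it is to become the
      inverse of \<open>z\<close>.\<close>
    define I where "I = {x \<in> carrier R. \<forall>s\<in>carrier R. \<forall>t\<in>carrier R.
      \<exists>c\<in>?C. f \<otimes> (s \<otimes> x \<otimes> t) \<otimes> f = z \<otimes> c}"
    have "rng_ideal I R"
    proof (rule rng_idealI)
      show "\<zero> \<in> I" unfolding I_def using f zc C0 by (auto intro!: bexI[of _ \<zero>] simp: rng_m_closed)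
    next
      fix x y assume x: "x \<in> I" and y: "y \<in> I"
      have xy: "x \<in> carrier R" "y \<in> carrier R" using x y by (auto simp: I_def)
      have "\<exists>c\<in>?C. f \<otimes> (s \<otimes> (x \<oplus> y) \<otimes> t) \<otimes> f = z \<otimes> c" if st: "s \<in> carrier R" "t \<in> carrier R" for s t
      proof -
        obtain c where c: "c \<in> ?C" "f \<otimes> (s \<otimes> x \<otimes> t) \<otimes> f = z \<otimes> c" using x st by (auto simp: I_def)
        obtain d where d: "d \<in> ?C" "f \<otimes> (s \<otimes> y \<otimes> t) \<otimes> f = z \<otimes> d" using y st by (auto simp: I_def)
        have "f \<otimes> (s \<otimes> (x \<oplus> y) \<otimes> t) \<otimes> f = z \<otimes> (c \<oplus> d)"
          using c d zc st xy cl[OF c(1)] cl[OF d(1)] f by (simp add: rng_r_distr rng_l_distr rng_m_closed)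
        then show ?thesis using Ca c d by blast
      qed
      then show "x \<oplus> y \<in> I" using xy by (auto simp: I_def)
    next
      fix x assume x: "x \<in> I"
      have xy: "x \<in> carrier R" using x by (auto simp: I_def)
      have "\<exists>c\<in>?C. f \<otimes> (s \<otimes> (\<ominus> x) \<otimes> t) \<otimes> f = z \<otimes> c" if st: "s \<in> carrier R" "t \<in> carrier R" for s t
      proof -
        obtain c where c: "c \<in> ?C" "f \<otimes> (s \<otimes> x \<otimes> t) \<otimes> f = z \<otimes> c" using x st by (auto simp: I_def)
        have "f \<otimes> (s \<otimes> (\<ominus> x) \<otimes> t) \<otimes> f = z \<otimes> (\<ominus> c)"
          using c zc st xy cl[OF c(1)] f by (simp add: rng_r_minus rng_l_minus rng_m_closed)
        then show ?thesis using Cn c by blast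
      qed
      then show "\<ominus> x \<in> I" using xy by (auto simp: I_def)
    next
      fix a x assume a: "a \<in> I" and x: "x \<in> carrier R"
      have ac: "a \<in> carrier R" using a by (auto simp: I_def)
      have "\<exists>c\<in>?C. f \<otimes> (s \<otimes> (x \<otimes> a) \<otimes> t) \<otimes> f = z \<otimes> c" if st: "s \<in> carrier R" "t \<in> carrier R" for s t
      proof -
        have "s \<otimes> (x \<otimes> a) \<otimes> t = (s \<otimes> x) \<otimes> a \<otimes> t" using st x ac by (simp add: rng_m_assoc)
        then show ?thesis using a st x by (simp add: I_def rng_m_closed)
      qed
      then show "x \<otimes> a \<in> I" using ac x by (auto simp: I_def rng_m_closed)
      have "\<exists>c\<in>?C. f \<otimes> (s \<otimes> (a \<otimes> x) \<otimes> t) \<otimes> f = z \<otimes> c" if st: "s \<in> carrier R" "t \<in> carrier R" for s t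
      proof -
        have "s \<otimes> (a \<otimes> x) \<otimes> t = s \<otimes> a \<otimes> (x \<otimes> t)" using st x ac by (simp add: rng_m_assoc rng_m_closed)
        then show ?thesis using a st x by (simp add: I_def rng_m_closed)
      qed
      then show "a \<otimes> x \<in> I" using ac x by (auto simp: I_def rng_m_closed)
    qed (auto simp: I_def)
    moreover have "z \<in> I"
    proof -
      \<comment> \<open>Since \<open>z = f z f\<close>, the neighbours of \<open>z\<close> may be
        replaced by \<open>f s f\<close> and \<open>f t f\<close>, which lie in the corner and
        therefore commute with \<open>z\<close>.\<close>
      have "f \<otimes> (s \<otimes> z \<otimes> t) \<otimes> f = z \<otimes> ((f \<otimes> s \<otimes> f) \<otimes> (f \<otimes> t \<otimes> f))"
        if st: "s \<in> carrier R" "t \<in> carrier R" for s t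
      proof -
        have "f \<otimes> (s \<otimes> z \<otimes> t) \<otimes> f = f \<otimes> (s \<otimes> ((f \<otimes> z) \<otimes> f) \<otimes> t) \<otimes> f"
          using z(1) C_iff by simp
        also have "\<dots> = (f \<otimes> s \<otimes> f) \<otimes> z \<otimes> (f \<otimes> t \<otimes> f)"
          using st zc f by (simp add: rng_m_assoc rng_m_closed)
        also have "\<dots> = z \<otimes> (f \<otimes> s \<otimes> f) \<otimes> (f \<otimes> t \<otimes> f)"
          using z(2)[OF fxf[OF st(1)]] by simp
        finally show ?thesis using st zc f by (simp add: rng_m_assoc rng_m_closed)
      qed
      then show ?thesis unfolding I_def using zc Cm[OF fxf fxf] by blast
    qed
    ultimately have "I = carrier R" using simple_ideals z(3) by blast
    then have "f \<in> I" using f by simp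
    \<comment> \<open>Membership of \<open>f\<close> in \<open>I\<close> is evaluated at
      \<open>s = t = f\<close>.\<close>
    then obtain w where w: "w \<in> ?C" "f \<otimes> (f \<otimes> f \<otimes> f) \<otimes> f = z \<otimes> w"
      using f(1) unfolding I_def by blast
    then have zw: "z \<otimes> w = f" using f by simp
    have wz: "w \<otimes> z = f" using z(2)[OF w(1)] zw by simp
    \<comment> \<open>The inverse of a central element is central:
      \<open>w x = w x z w = w z x w = x w\<close>.\<close>
    have "w \<otimes> x = x \<otimes> w" if x: "x \<in> ?C" for x
    proof -
      have "w \<otimes> x = w \<otimes> x \<otimes> (z \<otimes> w)" using zw Cm[OF w(1) x] C_iff by metis
      also have "\<dots> = w \<otimes> (x \<otimes> z) \<otimes> w" using cl x w zc by (simp add: rng_m_assoc rng_m_closed)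
      also have "\<dots> = w \<otimes> (z \<otimes> x) \<otimes> w" using z(2)[OF x] by simp
      also have "\<dots> = (w \<otimes> z) \<otimes> (x \<otimes> w)" using cl x w zc by (simp add: rng_m_assoc rng_m_closed)
      also have "\<dots> = x \<otimes> w" using wz Cm[OF x w(1)] C_iff by metis
      finally show ?thesis .
    qed
    then have "w \<in> carrier ?Z" using w(1) Z_iff by blast
    then show "z \<in> Units ?Z" using z(4) zw wz by (auto simp: Units_def)
  qed
qed

subsection \<open>The partial skew group ring\<close>

locale locally_unital_partial_action = partial_action +
  assumes D_local_units: "g \<in> carrier G \<Longrightarrow> has_local_units (A\<lparr>carrier := D g\<rparr>)"
begin

abbreviation "S \<equiv> skew_group_ring G A D \<alpha>"
abbreviation "monom a g \<equiv> skew_monom G A a g"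
abbreviation "support x \<equiv> supp G A x"

text \<open>The coefficient of the product of \<open>x \<delta>\<^sub>g\<close> and
  \<open>y \<delta>\<^sub>h\<close>; it does not depend on \<open>h\<close>. As
  \<open>D (inv g)\<close> is an ideal, \<open>y\<close> may range over all of
  \<open>A\<close>.\<close>

definition twist :: "'a \<Rightarrow> 'c \<Rightarrow> 'c \<Rightarrow> 'c"
  where "twist g x y = \<alpha> g (\<alpha> (inv g) x \<otimes>\<^bsub>A\<^esub> y)"

section \<open>The ideals \<open>D g\<close>, the isomorphisms \<open>\<alpha> g\<close> and local
  units\<close>

lemma D_carrier: "g \<in> carrier G \<Longrightarrow> x \<in> D g \<Longrightarrow> x \<in> carrier A"
  using rng_ideal.mem_carrier[OF D_ideal] .

lemma D_zero [simp]: "g \<in> carrier G \<Longrightarrow> \<zero>\<^bsub>A\<^esub> \<in> D g"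
  using D_ideal rng_ideal_def additive_subgroup.zero_closed by metis

lemma D_add: "g \<in> carrier G \<Longrightarrow> x \<in> D g \<Longrightarrow> y \<in> D g \<Longrightarrow> x \<oplus>\<^bsub>A\<^esub> y \<in> D g"
  using D_ideal rng_ideal_def additive_subgroup.a_closed by metis

lemma D_neg: "g \<in> carrier G \<Longrightarrow> x \<in> D g \<Longrightarrow> \<ominus>\<^bsub>A\<^esub> x \<in> D g"
  using D_ideal rng_ideal_def additive_subgroup.a_inv_closed A.abelian_group_axioms by metis

lemma D_mult_left: "g \<in> carrier G \<Longrightarrow> x \<in> carrier A \<Longrightarrow> y \<in> D g \<Longrightarrow> x \<otimes>\<^bsub>A\<^esub> y \<in> D g"
  using D_ideal rng_ideal.rng_I_l_closed by metis

lemma D_mult_right: "g \<in> carrier G \<Longrightarrow> x \<in> D g \<Longrightarrow> y \<in> carrier A \<Longrightarrow> x \<otimes>\<^bsub>A\<^esub> y \<in> D g"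
  using D_ideal rng_ideal.rng_I_r_closed by metis

lemma D_finsum: "g \<in> carrier G \<Longrightarrow> finite F \<Longrightarrow> f \<in> F \<rightarrow> D g \<Longrightarrow> finsum A f F \<in> D g"
  using D_ideal rng_ideal_def additive_subgroup.finsum_closed_subgroup A.abelian_group_axioms by metis

lemma \<alpha>_closed: "g \<in> carrier G \<Longrightarrow> x \<in> D (inv g) \<Longrightarrow> \<alpha> g x \<in> D g"
  using \<alpha>_iso[of g] by (auto simp: rng_iso_def iso_def hom_def)

lemma \<alpha>_closed': "g \<in> carrier G \<Longrightarrow> x \<in> D g \<Longrightarrow> \<alpha> (inv g) x \<in> D (inv g)"
  using \<alpha>_closed[of "inv g"] by simp

lemma \<alpha>_add: "g \<in> carrier G \<Longrightarrow> x \<in> D (inv g) \<Longrightarrow> y \<in> D (inv g) \<Longrightarrow>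
    \<alpha> g (x \<oplus>\<^bsub>A\<^esub> y) = \<alpha> g x \<oplus>\<^bsub>A\<^esub> \<alpha> g y"
  using \<alpha>_iso[of g] by (auto simp: rng_iso_def iso_def hom_def)

lemma \<alpha>_mult: "g \<in> carrier G \<Longrightarrow> x \<in> D (inv g) \<Longrightarrow> y \<in> D (inv g) \<Longrightarrow>
    \<alpha> g (x \<otimes>\<^bsub>A\<^esub> y) = \<alpha> g x \<otimes>\<^bsub>A\<^esub> \<alpha> g y"
  using \<alpha>_iso[of g] by (auto simp: rng_iso_def iso_def hom_def)

lemma \<alpha>_zero: "g \<in> carrier G \<Longrightarrow> \<alpha> g \<zero>\<^bsub>A\<^esub> = \<zero>\<^bsub>A\<^esub>"
proof -
  assume g: "g \<in> carrier G"
  have "\<alpha> g \<zero>\<^bsub>A\<^esub> \<oplus>\<^bsub>A\<^esub> \<alpha> g \<zero>\<^bsub>A\<^esub> = \<alpha> g \<zero>\<^bsub>A\<^esub>"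
    using \<alpha>_add[of g "\<zero>\<^bsub>A\<^esub>" "\<zero>\<^bsub>A\<^esub>"] g by simp
  moreover have "\<alpha> g \<zero>\<^bsub>A\<^esub> \<in> carrier A" using \<alpha>_closed[of g "\<zero>\<^bsub>A\<^esub>"] g D_carrier by simp
  ultimately show ?thesis by (metis A.add.r_cancel_one')
qed

lemma \<alpha>_inverse: "g \<in> carrier G \<Longrightarrow> x \<in> D g \<Longrightarrow> \<alpha> g (\<alpha> (inv g) x) = x"
  using \<alpha>_comp[of g "inv g" x] D_carrier by (simp add: D_one \<alpha>_one)

lemma \<alpha>_inverse': "g \<in> carrier G \<Longrightarrow> x \<in> D (inv g) \<Longrightarrow> \<alpha> (inv g) (\<alpha> g x) = x"
  using \<alpha>_inverse[of "inv g" x] by simp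

lemma local_unit:
  assumes "g \<in> carrier G" "finite X" "X \<subseteq> D g"
  shows "\<exists>u\<in>D g. \<forall>x\<in>X. u \<otimes>\<^bsub>A\<^esub> x = x \<and> x \<otimes>\<^bsub>A\<^esub> u = x"
proof -
  obtain E where E: "set_of_local_units (A\<lparr>carrier := D g\<rparr>) E"
    using D_local_units[OF assms(1)] by (auto simp: has_local_units_def)
  then obtain u where "u \<in> E" and X: "X \<subseteq> corner_set (A\<lparr>carrier := D g\<rparr>) u"
    using assms(2,3) unfolding set_of_local_units_def by auto
  then have u: "u \<in> D g" "u \<otimes>\<^bsub>A\<^esub> u = u" using E unfolding set_of_local_units_def by auto
  have uA: "u \<in> carrier A" using D_carrier assms u by blast
  \<comment> \<open>The idempotent \<open>u\<close> comes from the ring \<open>D g\<close>. The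
    corner of \<open>D g\<close> at \<open>u\<close> lies in that of \<open>A\<close>, whose members
    are exactly the elements fixed by \<open>u\<close> on both sides.\<close>
  have "corner_set (A\<lparr>carrier := D g\<rparr>) u \<subseteq> corner_set A u"
    using D_carrier[OF assms(1)] by (auto simp: corner_set_def)
  then show ?thesis using X u(1) A.corner_set_fixed[OF uA u(2)] by blast
qed

section \<open>Coefficients of products of monomials\<close>

lemma twist_closed: "g \<in> carrier G \<Longrightarrow> x \<in> D g \<Longrightarrow> y \<in> carrier A \<Longrightarrow> twist g x y \<in> D g"
  unfolding twist_def by (intro \<alpha>_closed D_mult_right \<alpha>_closed') auto

lemma twist_closed_A: "g \<in> carrier G \<Longrightarrow> x \<in> D g \<Longrightarrow> y \<in> carrier A \<Longrightarrow> twist g x y \<in> carrier A"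
  using twist_closed D_carrier by blast

text \<open>The argument of \<open>\<alpha> g\<close> lies in \<open>D (inv g)\<close> because of
  its left factor and in \<open>D h\<close> because of its right factor, and
  \<open>\<alpha> g\<close> maps this intersection onto
  \<open>D g \<inter> D (g \<otimes> h)\<close>.\<close>

lemma twist_closed_mult:
  assumes "g \<in> carrier G" "h \<in> carrier G" "x \<in> D g" "y \<in> D h"
  shows "twist g x y \<in> D (g \<otimes> h)"
proof -
  have "\<alpha> (inv g) x \<in> D (inv g)" using assms \<alpha>_closed' by blast
  then have "\<alpha> (inv g) x \<otimes>\<^bsub>A\<^esub> y \<in> D (inv g) \<inter> D h"
    using assms D_mult_right[of "inv g"] D_mult_left[of h] D_carrier by (meson IntI inv_closed)
  then show ?thesis using \<alpha>_image[of g h] assms unfolding twist_def by blast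
qed

lemma twist_zero_left [simp]: "g \<in> carrier G \<Longrightarrow> y \<in> carrier A \<Longrightarrow> twist g \<zero>\<^bsub>A\<^esub> y = \<zero>\<^bsub>A\<^esub>"
  by (simp add: twist_def \<alpha>_zero)

lemma twist_zero_right [simp]: "g \<in> carrier G \<Longrightarrow> x \<in> D g \<Longrightarrow> twist g x \<zero>\<^bsub>A\<^esub> = \<zero>\<^bsub>A\<^esub>"
  unfolding twist_def using \<alpha>_closed' D_carrier by (metis A.rng_zero_right \<alpha>_zero inv_closed)

lemma twist_add_left:
  assumes "g \<in> carrier G" "x \<in> D g" "x' \<in> D g" "y \<in> carrier A"
  shows "twist g (x \<oplus>\<^bsub>A\<^esub> x') y = twist g x y \<oplus>\<^bsub>A\<^esub> twist g x' y"
proof -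
  have "\<alpha> (inv g) (x \<oplus>\<^bsub>A\<^esub> x') = \<alpha> (inv g) x \<oplus>\<^bsub>A\<^esub> \<alpha> (inv g) x'" using \<alpha>_add[of "inv g"] assms by simp
  moreover have "\<alpha> (inv g) x \<in> D (inv g)" "\<alpha> (inv g) x' \<in> D (inv g)" using assms \<alpha>_closed' by auto
  ultimately show ?thesis unfolding twist_def
    using assms D_carrier[of "inv g"] by (simp add: A.rng_l_distr \<alpha>_add D_mult_right)
qed

lemma twist_add_right:
  assumes "g \<in> carrier G" "x \<in> D g" "y \<in> carrier A" "y' \<in> carrier A"
  shows "twist g x (y \<oplus>\<^bsub>A\<^esub> y') = twist g x y \<oplus>\<^bsub>A\<^esub> twist g x y'"
proof -
  have "\<alpha> (inv g) x \<in> D (inv g)" using assms \<alpha>_closed' by auto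
  then show ?thesis unfolding twist_def
    using assms D_carrier[of "inv g"] by (simp add: A.rng_r_distr \<alpha>_add D_mult_right)
qed

lemma twist_one: "x \<in> carrier A \<Longrightarrow> y \<in> carrier A \<Longrightarrow> twist \<one> x y = x \<otimes>\<^bsub>A\<^esub> y"
  by (simp add: twist_def \<alpha>_one A.rng_m_closed)

text \<open>Replacing \<open>c\<close> by \<open>c v\<close> with a local unit \<open>v\<close> of \<open>D g\<close> moves the factor into the domain
  of \<open>\<alpha> (inv g)\<close>; this is the only point at which associativity needs the local units.\<close>

lemma mult_twist:
  assumes "g \<in> carrier G" "x \<in> D g" "y \<in> carrier A" "c \<in> carrier A"
  shows "twist g (c \<otimes>\<^bsub>A\<^esub> x) y = c \<otimes>\<^bsub>A\<^esub> twist g x y"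
proof -
  have tw: "twist g x y \<in> D g" using assms twist_closed by blast
  obtain v where v: "v \<in> D g" "v \<otimes>\<^bsub>A\<^esub> x = x" "v \<otimes>\<^bsub>A\<^esub> twist g x y = twist g x y"
    using local_unit[of g "{x, twist g x y}"] assms(1,2) tw by auto
  have cv: "c \<otimes>\<^bsub>A\<^esub> v \<in> D g" using assms v D_mult_left by blast
  have mem: "\<alpha> (inv g) (c \<otimes>\<^bsub>A\<^esub> v) \<in> D (inv g)" "\<alpha> (inv g) x \<in> D (inv g)" using assms cv \<alpha>_closed' by auto
  have "c \<otimes>\<^bsub>A\<^esub> x = (c \<otimes>\<^bsub>A\<^esub> v) \<otimes>\<^bsub>A\<^esub> x"
    using v assms D_carrier by (simp add: A.rng_m_assoc)
  then have "twist g (c \<otimes>\<^bsub>A\<^esub> x) y = \<alpha> g (\<alpha> (inv g) (c \<otimes>\<^bsub>A\<^esub> v) \<otimes>\<^bsub>A\<^esub> (\<alpha> (inv g) x \<otimes>\<^bsub>A\<^esub> y))"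
    unfolding twist_def using \<alpha>_mult[of "inv g" "c \<otimes>\<^bsub>A\<^esub> v" x] cv assms mem D_carrier[of "inv g"]
    by (simp add: A.rng_m_assoc)
  also have "\<dots> = (c \<otimes>\<^bsub>A\<^esub> v) \<otimes>\<^bsub>A\<^esub> twist g x y"
    unfolding twist_def using \<alpha>_mult[of g] mem assms D_mult_right[of "inv g"] cv by (simp add: \<alpha>_inverse)
  also have "\<dots> = c \<otimes>\<^bsub>A\<^esub> twist g x y"
    using v assms D_carrier tw by (metis A.rng_m_assoc)
  finally show ?thesis .
qed

text \<open>Let \<open>a' = \<alpha> (inv g) a\<close>. On the left-hand side
  \<open>\<alpha> (inv (g \<otimes> h))\<close> after \<open>\<alpha> g\<close> acts on
  \<open>a' b\<close> as \<open>\<alpha> (inv h)\<close>, and the outer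
  \<open>\<alpha> (g \<otimes> h)\<close> splits into \<open>\<alpha> g\<close> after
  \<open>\<alpha> h\<close>. Then \<open>mult_twist\<close> moves \<open>a'\<close> out of
  \<open>\<alpha> h\<close>, which gives the right-hand side.\<close>

lemma twist_assoc:
  assumes "g \<in> carrier G" "h \<in> carrier G" "a \<in> D g" "b \<in> D h" "c \<in> carrier A"
  shows "twist (g \<otimes> h) (twist g a b) c = twist g a (twist h b c)"
proof -
  define a' where "a' = \<alpha> (inv g) a"
  have a': "a' \<in> D (inv g)" using assms \<alpha>_closed' by (simp add: a'_def)
  then have a'A: "a' \<in> carrier A" using D_carrier assms by (meson inv_closed)
  have bA: "b \<in> carrier A" using assms D_carrier by blast
  have ab: "a' \<otimes>\<^bsub>A\<^esub> b \<in> D (inv g)" "a' \<otimes>\<^bsub>A\<^esub> b \<in> D h"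
    using a' a'A bA assms D_mult_right[of "inv g"] D_mult_left[of h] by auto
  let ?y = "\<alpha> (inv h) (a' \<otimes>\<^bsub>A\<^esub> b)"
  have eq: "\<alpha> (inv (g \<otimes> h)) (\<alpha> g (a' \<otimes>\<^bsub>A\<^esub> b)) = ?y"
  proof -
    have "inv (g \<otimes> h) \<otimes> g = inv h" using assms by (simp add: inv_mult_group m_assoc)
    then show ?thesis using \<alpha>_comp[of "inv (g \<otimes> h)" g "a' \<otimes>\<^bsub>A\<^esub> b"] assms ab by simp
  qed
  have "?y \<in> D (inv h) \<inter> D (inv h \<otimes> inv g)"
    using \<alpha>_image[of "inv h" "inv g"] ab assms by fastforce
  then have "?y \<otimes>\<^bsub>A\<^esub> c \<in> D (inv h) \<inter> D (inv (g \<otimes> h))"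
    using assms D_mult_right by (simp add: inv_mult_group)
  then have "\<alpha> (g \<otimes> h) (?y \<otimes>\<^bsub>A\<^esub> c) = \<alpha> g (\<alpha> h (?y \<otimes>\<^bsub>A\<^esub> c))"
    using \<alpha>_comp assms by simp
  moreover have "\<alpha> h (?y \<otimes>\<^bsub>A\<^esub> c) = a' \<otimes>\<^bsub>A\<^esub> twist h b c"
    using mult_twist[of h b c a'] assms a'A by (simp add: twist_def)
  ultimately have "\<alpha> (g \<otimes> h) (\<alpha> (inv (g \<otimes> h)) (\<alpha> g (a' \<otimes>\<^bsub>A\<^esub> b)) \<otimes>\<^bsub>A\<^esub> c) = \<alpha> g (a' \<otimes>\<^bsub>A\<^esub> twist h b c)"
    using eq by simp
  then show ?thesis by (simp add: twist_def a'_def)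
qed

section \<open>The additive group of formal sums and their convolution\<close>

lemma S_carrier_iff: "x \<in> carrier S \<longleftrightarrow> x \<in> (\<Pi>\<^sub>E g \<in> carrier G. D g) \<and> finite (support x)"
  by (simp add: skew_group_ring_def)

lemma S_coeff: "x \<in> carrier S \<Longrightarrow> g \<in> carrier G \<Longrightarrow> x g \<in> D g"
  by (auto simp: S_carrier_iff)

lemma S_coeff_A: "x \<in> carrier S \<Longrightarrow> g \<in> carrier G \<Longrightarrow> x g \<in> carrier A"
  using S_coeff D_carrier by blast

lemma twist_coeff_closed:
  "x \<in> carrier S \<Longrightarrow> y \<in> carrier S \<Longrightarrow> g \<in> carrier G \<Longrightarrow> h \<in> carrier G \<Longrightarrow> twist g (x g) (y h) \<in> carrier A"
  using twist_closed_A S_coeff S_coeff_A by blast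

lemma S_eqI: "x \<in> carrier S \<Longrightarrow> y \<in> carrier S \<Longrightarrow> (\<And>g. g \<in> carrier G \<Longrightarrow> x g = y g) \<Longrightarrow> x = y"
  unfolding S_carrier_iff by (blast intro: PiE_ext)

lemma S_zero_coeff [simp]: "g \<in> carrier G \<Longrightarrow> \<zero>\<^bsub>S\<^esub> g = \<zero>\<^bsub>A\<^esub>"
  by (simp add: skew_group_ring_def)

lemma S_add_coeff [simp]: "g \<in> carrier G \<Longrightarrow> (x \<oplus>\<^bsub>S\<^esub> y) g = x g \<oplus>\<^bsub>A\<^esub> y g"
  by (simp add: skew_group_ring_def)

lemma monom_coeff [simp]: "g \<in> carrier G \<Longrightarrow> monom a h g = (if g = h then a else \<zero>\<^bsub>A\<^esub>)"
  by (simp add: skew_monom_def)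

lemma support_finite: "x \<in> carrier S \<Longrightarrow> finite (support x)"
  by (simp add: S_carrier_iff)

lemma supportI: "g \<in> carrier G \<Longrightarrow> x g \<noteq> \<zero>\<^bsub>A\<^esub> \<Longrightarrow> g \<in> support x"
  by (simp add: supp_def)

lemma support_carrier: "support x \<subseteq> carrier G"
  by (auto simp: supp_def)

lemma S_abelian_group: "abelian_group S"
proof (rule abelian_groupI)
  have zero: "support \<zero>\<^bsub>S\<^esub> = {}" by (auto simp: supp_def)
  show z: "\<zero>\<^bsub>S\<^esub> \<in> carrier S"
    unfolding S_carrier_iff using zero by (auto simp: skew_group_ring_def)
  show cl: "x \<oplus>\<^bsub>S\<^esub> y \<in> carrier S" if "x \<in> carrier S" "y \<in> carrier S" for x y
  proof -
    have "support (x \<oplus>\<^bsub>S\<^esub> y) \<subseteq> support x \<union> support y" by (auto simp: supp_def)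
    then have "finite (support (x \<oplus>\<^bsub>S\<^esub> y))" using that support_finite by (meson finite_UnI finite_subset)
    moreover have "x \<oplus>\<^bsub>S\<^esub> y \<in> (\<Pi>\<^sub>E g \<in> carrier G. D g)"
      using that S_coeff by (auto simp: D_add) (simp add: skew_group_ring_def)
    ultimately show ?thesis by (simp add: S_carrier_iff)
  qed
  fix x assume x: "x \<in> carrier S"
  show "\<zero>\<^bsub>S\<^esub> \<oplus>\<^bsub>S\<^esub> x = x"
    by (rule S_eqI) (use x z cl S_coeff_A in auto)
  let ?y = "\<lambda>g\<in>carrier G. \<ominus>\<^bsub>A\<^esub> x g"
  have "support ?y \<subseteq> support x" by (auto simp: supp_def)
  then have y: "?y \<in> carrier S" unfolding S_carrier_iff
    using x S_coeff D_neg by (auto intro: finite_subset support_finite)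
  have "?y \<oplus>\<^bsub>S\<^esub> x = \<zero>\<^bsub>S\<^esub>"
    by (rule S_eqI) (use x y z cl S_coeff_A in \<open>auto simp: A.l_neg\<close>)
  then show "\<exists>y\<in>carrier S. y \<oplus>\<^bsub>S\<^esub> x = \<zero>\<^bsub>S\<^esub>" using y by blast
  fix y assume y: "y \<in> carrier S"
  show "x \<oplus>\<^bsub>S\<^esub> y = y \<oplus>\<^bsub>S\<^esub> x"
    by (rule S_eqI) (use x y cl S_coeff_A in \<open>auto simp: A.a_comm\<close>)
  fix w assume w: "w \<in> carrier S"
  show "x \<oplus>\<^bsub>S\<^esub> y \<oplus>\<^bsub>S\<^esub> w = x \<oplus>\<^bsub>S\<^esub> (y \<oplus>\<^bsub>S\<^esub> w)"
    by (rule S_eqI) (use x y w cl S_coeff_A in \<open>auto simp: A.a_assoc\<close>)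
qed

sublocale S: abelian_group S
  by (rule S_abelian_group)

text \<open>The pairs with product \<open>k\<close> are parametrised by their first entry. Enlarging
  the index set to any finite \<open>F\<close> adds only zero terms, so that products with different
  left factors can be compared as sums over one common set.\<close>

lemma S_mult_coeff:
  assumes "a \<in> carrier S" "b \<in> carrier S" "k \<in> carrier G"
    and F: "finite F" "support a \<subseteq> F" "F \<subseteq> carrier G"
  shows "(a \<otimes>\<^bsub>S\<^esub> b) k = finsum A (\<lambda>g. twist g (a g) (b (inv g \<otimes> k))) F"
proof -
  let ?f = "\<lambda>(g, h). twist g (a g) (b h)"
  let ?F' = "{g \<in> support a. inv g \<otimes> k \<in> support b}"
  let ?p = "\<lambda>g. (g, inv g \<otimes> k)"
  have P: "{(g, h). g \<in> support a \<and> h \<in> support b \<and> g \<otimes> h = k} = ?p ` ?F'" (is "?P = _")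
  proof -
    have "h = inv g \<otimes> k" if "g \<in> support a" "h \<in> support b" "g \<otimes> h = k" for g h
      using that support_carrier by (metis inv_solve_left' subsetD assms(3))
    moreover have "g \<otimes> (inv g \<otimes> k) = k" if "g \<in> support a" for g
      using that support_carrier assms(3) by (metis inv_solve_left' subsetD inv_closed m_closed)
    ultimately show ?thesis by (auto simp: image_iff)
  qed
  have tcl: "twist g (a g) (b h) \<in> carrier A" if "g \<in> carrier G" "h \<in> carrier G" for g h
    using that assms twist_coeff_closed by blast
  have "(a \<otimes>\<^bsub>S\<^esub> b) k = finsum A ?f (?p ` ?F')"
    using assms(3) by (simp add: skew_group_ring_def P twist_def flip: P)
  also have "\<dots> = finsum A (\<lambda>g. twist g (a g) (b (inv g \<otimes> k))) ?F'"
    using tcl support_carrier assms(3)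
    by (subst A.finsum_reindex) (auto simp: inj_on_def subset_iff)
  also have "\<dots> = finsum A (\<lambda>g. twist g (a g) (b (inv g \<otimes> k))) F"
  proof (rule A.add.finprod_mono_neutral_cong_left)
    fix g assume g: "g \<in> F - ?F'"
    then have gG: "g \<in> carrier G" "inv g \<otimes> k \<in> carrier G" using F assms(3) by auto
    then have "a g = \<zero>\<^bsub>A\<^esub> \<or> b (inv g \<otimes> k) = \<zero>\<^bsub>A\<^esub>" using g by (auto simp: supp_def)
    then show "twist g (a g) (b (inv g \<otimes> k)) = \<zero>\<^bsub>A\<^esub>"
      using gG assms S_coeff S_coeff_A by auto
  qed (use F tcl assms(3) in auto)
  finally show ?thesis .
qed

lemma S_mult_support:
  assumes "a \<in> carrier S" "b \<in> carrier S"
  shows "support (a \<otimes>\<^bsub>S\<^esub> b) \<subseteq> (\<lambda>(g, h). g \<otimes> h) ` (support a \<times> support b)"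
proof
  fix k assume k: "k \<in> support (a \<otimes>\<^bsub>S\<^esub> b)"
  then have kG: "k \<in> carrier G" "(a \<otimes>\<^bsub>S\<^esub> b) k \<noteq> \<zero>\<^bsub>A\<^esub>" by (auto simp: supp_def)
  then have "finsum A (\<lambda>g. twist g (a g) (b (inv g \<otimes> k))) (support a) \<noteq> \<zero>\<^bsub>A\<^esub>"
    using S_mult_coeff[OF assms kG(1), of "support a"] support_finite[OF assms(1)] support_carrier by simp
  then obtain g where g: "g \<in> support a" "twist g (a g) (b (inv g \<otimes> k)) \<noteq> \<zero>\<^bsub>A\<^esub>"
    using A.add.finprod_one_eqI[of "support a" "\<lambda>g. twist g (a g) (b (inv g \<otimes> k))"] by blast
  then have gG: "g \<in> carrier G" using support_carrier by blast
  then have "b (inv g \<otimes> k) \<noteq> \<zero>\<^bsub>A\<^esub>" using g assms S_coeff by force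
  then have "inv g \<otimes> k \<in> support b" using gG kG by (auto intro: supportI)
  moreover have "k = g \<otimes> (inv g \<otimes> k)" using gG kG by (simp flip: m_assoc)
  ultimately show "k \<in> (\<lambda>(g, h). g \<otimes> h) ` (support a \<times> support b)" using g by (auto simp: image_iff)
qed

lemma S_mult_closed:
  assumes "a \<in> carrier S" "b \<in> carrier S"
  shows "a \<otimes>\<^bsub>S\<^esub> b \<in> carrier S"
proof -
  have "finite (support (a \<otimes>\<^bsub>S\<^esub> b))"
    using S_mult_support[OF assms] support_finite assms by (meson finite_SigmaI finite_imageI finite_subset)
  moreover have "(a \<otimes>\<^bsub>S\<^esub> b) k \<in> D k" if k: "k \<in> carrier G" for k
  proof -
    have "twist g (a g) (b (inv g \<otimes> k)) \<in> D k" if g: "g \<in> carrier G" for g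
      using twist_closed_mult[of g "inv g \<otimes> k"] S_coeff assms g k by (simp flip: m_assoc)
    then have "finsum A (\<lambda>g. twist g (a g) (b (inv g \<otimes> k))) (support a) \<in> D k"
      using support_carrier[of a] support_finite[OF assms(1)] by (intro D_finsum[OF k]) auto
    then show ?thesis
      using S_mult_coeff[OF assms k, of "support a"] support_finite[OF assms(1)] support_carrier by simp
  qed
  ultimately show ?thesis unfolding S_carrier_iff by (auto simp: skew_group_ring_def)
qed

lemma S_l_distr:
  assumes "a \<in> carrier S" "b \<in> carrier S" "c \<in> carrier S"
  shows "(a \<oplus>\<^bsub>S\<^esub> b) \<otimes>\<^bsub>S\<^esub> c = a \<otimes>\<^bsub>S\<^esub> c \<oplus>\<^bsub>S\<^esub> b \<otimes>\<^bsub>S\<^esub> c"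
proof (rule S_eqI)
  fix k assume k: "k \<in> carrier G"
  let ?F = "support a \<union> support b \<union> support (a \<oplus>\<^bsub>S\<^esub> b)"
  have F: "finite ?F" "?F \<subseteq> carrier G" using assms support_finite support_carrier by auto
  have t: "twist g (a g) (c (inv g \<otimes> k)) \<in> carrier A" "twist g (b g) (c (inv g \<otimes> k)) \<in> carrier A"
    "twist g ((a \<oplus>\<^bsub>S\<^esub> b) g) (c (inv g \<otimes> k)) =
      twist g (a g) (c (inv g \<otimes> k)) \<oplus>\<^bsub>A\<^esub> twist g (b g) (c (inv g \<otimes> k))" if "g \<in> ?F" for g
  proof -
    have g: "g \<in> carrier G" "inv g \<otimes> k \<in> carrier G" using that F k by auto
    then show "twist g (a g) (c (inv g \<otimes> k)) \<in> carrier A" "twist g (b g) (c (inv g \<otimes> k)) \<in> carrier A"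
      using assms twist_coeff_closed by auto
    show "twist g ((a \<oplus>\<^bsub>S\<^esub> b) g) (c (inv g \<otimes> k)) =
        twist g (a g) (c (inv g \<otimes> k)) \<oplus>\<^bsub>A\<^esub> twist g (b g) (c (inv g \<otimes> k))"
      using g assms S_coeff S_coeff_A by (simp add: twist_add_left)
  qed
  have "((a \<oplus>\<^bsub>S\<^esub> b) \<otimes>\<^bsub>S\<^esub> c) k = finsum A (\<lambda>g. twist g ((a \<oplus>\<^bsub>S\<^esub> b) g) (c (inv g \<otimes> k))) ?F"
    using F k assms by (intro S_mult_coeff) auto
  also have "\<dots> = finsum A (\<lambda>g. twist g (a g) (c (inv g \<otimes> k)) \<oplus>\<^bsub>A\<^esub> twist g (b g) (c (inv g \<otimes> k))) ?F"
    using t by (intro A.finsum_cong') auto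
  also have "\<dots> = (a \<otimes>\<^bsub>S\<^esub> c) k \<oplus>\<^bsub>A\<^esub> (b \<otimes>\<^bsub>S\<^esub> c) k"
    using F t k assms by (subst (1 2) S_mult_coeff[of _ _ _ ?F]) (auto intro!: A.finsum_addf)
  finally show "((a \<oplus>\<^bsub>S\<^esub> b) \<otimes>\<^bsub>S\<^esub> c) k = (a \<otimes>\<^bsub>S\<^esub> c \<oplus>\<^bsub>S\<^esub> b \<otimes>\<^bsub>S\<^esub> c) k" using k by simp
qed (use assms S_mult_closed in auto)

lemma S_r_distr:
  assumes "a \<in> carrier S" "b \<in> carrier S" "c \<in> carrier S"
  shows "c \<otimes>\<^bsub>S\<^esub> (a \<oplus>\<^bsub>S\<^esub> b) = c \<otimes>\<^bsub>S\<^esub> a \<oplus>\<^bsub>S\<^esub> c \<otimes>\<^bsub>S\<^esub> b"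
proof (rule S_eqI)
  fix k assume k: "k \<in> carrier G"
  let ?F = "support c"
  have F: "finite ?F" "?F \<subseteq> carrier G" using assms support_finite support_carrier by auto
  have t: "twist g (c g) (a (inv g \<otimes> k)) \<in> carrier A" "twist g (c g) (b (inv g \<otimes> k)) \<in> carrier A"
    "twist g (c g) ((a \<oplus>\<^bsub>S\<^esub> b) (inv g \<otimes> k)) =
      twist g (c g) (a (inv g \<otimes> k)) \<oplus>\<^bsub>A\<^esub> twist g (c g) (b (inv g \<otimes> k))" if "g \<in> ?F" for g
  proof -
    have g: "g \<in> carrier G" "inv g \<otimes> k \<in> carrier G" using that F k by auto
    then show "twist g (c g) (a (inv g \<otimes> k)) \<in> carrier A" "twist g (c g) (b (inv g \<otimes> k)) \<in> carrier A"
      using assms twist_coeff_closed by auto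
    show "twist g (c g) ((a \<oplus>\<^bsub>S\<^esub> b) (inv g \<otimes> k)) =
        twist g (c g) (a (inv g \<otimes> k)) \<oplus>\<^bsub>A\<^esub> twist g (c g) (b (inv g \<otimes> k))"
      using g assms S_coeff S_coeff_A by (simp add: twist_add_right)
  qed
  have "(c \<otimes>\<^bsub>S\<^esub> (a \<oplus>\<^bsub>S\<^esub> b)) k = finsum A (\<lambda>g. twist g (c g) ((a \<oplus>\<^bsub>S\<^esub> b) (inv g \<otimes> k))) ?F"
    using F k assms by (intro S_mult_coeff) auto
  also have "\<dots> = finsum A (\<lambda>g. twist g (c g) (a (inv g \<otimes> k)) \<oplus>\<^bsub>A\<^esub> twist g (c g) (b (inv g \<otimes> k))) ?F"
    using t by (intro A.finsum_cong') auto
  also have "\<dots> = (c \<otimes>\<^bsub>S\<^esub> a) k \<oplus>\<^bsub>A\<^esub> (c \<otimes>\<^bsub>S\<^esub> b) k"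
    using F t k assms by (subst (1 2) S_mult_coeff[of _ _ _ ?F]) (auto intro!: A.finsum_addf)
  finally show "(c \<otimes>\<^bsub>S\<^esub> (a \<oplus>\<^bsub>S\<^esub> b)) k = (c \<otimes>\<^bsub>S\<^esub> a \<oplus>\<^bsub>S\<^esub> c \<otimes>\<^bsub>S\<^esub> b) k" using k by simp
qed (use assms S_mult_closed in auto)

section \<open>Monomials and the associative law\<close>

lemma monom_closed: "g \<in> carrier G \<Longrightarrow> a \<in> D g \<Longrightarrow> monom a g \<in> carrier S"
  unfolding S_carrier_iff
  by (auto simp: skew_monom_def intro: finite_subset[of _ "{g}"] simp: supp_def)

lemma monom_support: "support (monom a g) \<subseteq> {g}"
  by (auto simp: supp_def split: if_splits)

lemma monom_mult_coeff:
  assumes "g \<in> carrier G" "a \<in> D g" "x \<in> carrier S" "k \<in> carrier G"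
  shows "(monom a g \<otimes>\<^bsub>S\<^esub> x) k = twist g a (x (inv g \<otimes> k))"
proof -
  have "twist g a (x (inv g \<otimes> k)) \<in> carrier A"
    using assms twist_closed_A S_coeff_A by simp
  then show ?thesis
    using assms monom_closed monom_support by (subst S_mult_coeff[where F = "{g}"]) auto
qed

lemma mult_monom_coeff:
  assumes "g \<in> carrier G" "a \<in> D g" "x \<in> carrier S" "k \<in> carrier G"
  shows "(x \<otimes>\<^bsub>S\<^esub> monom a g) k = twist (k \<otimes> inv g) (x (k \<otimes> inv g)) a"
proof -
  \<comment> \<open>Only the index \<open>k \<otimes> inv g\<close> can contribute to the sum; it is
    adjoined to the support because \<open>x\<close> may vanish there.\<close>
  let ?h = "k \<otimes> inv g" and ?F = "insert (k \<otimes> inv g) (support x)"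
  have h: "?h \<in> carrier G" using assms by simp
  have aA: "a \<in> carrier A" using assms D_carrier by blast
  have cl: "twist ?h (x ?h) a \<in> carrier A"
    using assms twist_closed_A S_coeff aA h by blast
  have F: "finite ?F" "?F \<subseteq> carrier G" using assms support_finite support_carrier by auto
  have eq: "inv g' \<otimes> k = g \<longleftrightarrow> g' = ?h" if "g' \<in> carrier G" for g'
    using that assms by (metis inv_closed inv_inv inv_solve_left inv_solve_right m_closed)
  have "(x \<otimes>\<^bsub>S\<^esub> monom a g) k = finsum A (\<lambda>g'. twist g' (x g') (monom a g (inv g' \<otimes> k))) ?F"
    using assms monom_closed F by (intro S_mult_coeff) auto
  also have "\<dots> = finsum A (\<lambda>g'. twist g' (x g') a) {?h}"
  proof (rule A.add.finprod_mono_neutral_cong_right)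
    show "twist g' (x g') (monom a g (inv g' \<otimes> k)) = \<zero>\<^bsub>A\<^esub>" if "g' \<in> ?F - {?h}" for g'
    proof -
      have "g' \<in> carrier G" "inv g' \<otimes> k \<noteq> g" using that F eq by auto
      then show ?thesis using assms S_coeff by simp
    qed
    show "twist g' (x g') (monom a g (inv g' \<otimes> k)) = twist g' (x g') a" if "g' \<in> {?h}" for g'
      using that eq[OF h] h assms by simp
    show "(\<lambda>g'. twist g' (x g') (monom a g (inv g' \<otimes> k))) \<in> ?F \<rightarrow> carrier A"
    proof (rule Pi_I)
      fix g' assume "g' \<in> ?F"
      then have "g' \<in> carrier G" "inv g' \<otimes> k \<in> carrier G" using F assms by auto
      then show "twist g' (x g') (monom a g (inv g' \<otimes> k)) \<in> carrier A"
        using twist_coeff_closed[OF assms(3) monom_closed[OF assms(1,2)]] by blast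
    qed
  qed (use F in auto)
  also have "\<dots> = twist ?h (x ?h) a" using cl by simp
  finally show ?thesis .
qed

lemma monom_mult_monom:
  assumes "g \<in> carrier G" "h \<in> carrier G" "a \<in> D g" "b \<in> D h"
  shows "monom a g \<otimes>\<^bsub>S\<^esub> monom b h = monom (twist g a b) (g \<otimes> h)"
proof (rule S_eqI)
  show "(monom a g \<otimes>\<^bsub>S\<^esub> monom b h) k = monom (twist g a b) (g \<otimes> h) k" if "k \<in> carrier G" for k
  proof -
    have "inv g \<otimes> k = h \<longleftrightarrow> k = g \<otimes> h" using that assms by (metis inv_solve_left' m_closed)
    then show ?thesis using that assms by (simp add: monom_mult_coeff monom_closed)
  qed
qed (use assms monom_closed S_mult_closed twist_closed_mult in auto)

text \<open>Coefficients are split off one at a time, by induction on a finite set containing the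
  support. Zero needs no case of its own, since it is a monomial with coefficient zero.\<close>

lemma S_induct [consumes 1, case_names monom add]:
  assumes "x \<in> carrier S"
    and monom: "\<And>a g. g \<in> carrier G \<Longrightarrow> a \<in> D g \<Longrightarrow> P (monom a g)"
    and add: "\<And>x y. x \<in> carrier S \<Longrightarrow> y \<in> carrier S \<Longrightarrow> P x \<Longrightarrow> P y \<Longrightarrow> P (x \<oplus>\<^bsub>S\<^esub> y)"
  shows "P x"
proof -
  have "\<forall>x\<in>carrier S. support x \<subseteq> F \<longrightarrow> P x" if "finite F" for F
    using that
  proof (induction F rule: finite_induct)
    case empty
    have "x = monom \<zero>\<^bsub>A\<^esub> \<one>" if "x \<in> carrier S" "support x \<subseteq> {}" for x
      by (rule S_eqI) (use that in \<open>auto simp: monom_closed intro: supportI\<close>)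
    then show ?case using monom[of \<one> "\<zero>\<^bsub>A\<^esub>"] by auto
  next
    case (insert g F)
    show ?case
    proof (intro ballI impI)
      fix x assume x: "x \<in> carrier S" "support x \<subseteq> insert g F"
      show "P x"
      proof (cases "g \<in> carrier G")
        case False
        then have "support x \<subseteq> F" using x support_carrier by blast
        then show ?thesis using insert x by blast
      next
        case True
        let ?y = "\<lambda>k\<in>carrier G. if k = g then \<zero>\<^bsub>A\<^esub> else x k"
        have y: "support ?y \<subseteq> F" using x(2) by (auto simp: supp_def split: if_splits)
        then have yS: "?y \<in> carrier S" unfolding S_carrier_iff
          using x insert S_coeff by (auto intro: finite_subset)
        have m: "monom (x g) g \<in> carrier S" using True x S_coeff monom_closed by blast
        have "x = monom (x g) g \<oplus>\<^bsub>S\<^esub> ?y"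
          by (rule S_eqI) (use x(1) yS m S_coeff_A in auto)
        moreover have "P ?y" using insert y yS by blast
        ultimately show ?thesis using add[OF m yS] monom True x S_coeff by metis
      qed
    qed
  qed
  then show ?thesis using assms(1) support_finite by blast
qed

text \<open>Distributivity reduces all three factors to monomials, for which the law is
  \<open>twist_assoc\<close>.\<close>

lemma S_assoc:
  assumes "x \<in> carrier S" "y \<in> carrier S" "z \<in> carrier S"
  shows "x \<otimes>\<^bsub>S\<^esub> y \<otimes>\<^bsub>S\<^esub> z = x \<otimes>\<^bsub>S\<^esub> (y \<otimes>\<^bsub>S\<^esub> z)"
  using assms(1)
proof (induction x rule: S_induct)
  case x: (monom a g)
  show ?case using assms(2)
  proof (induction y rule: S_induct)
    case y: (monom b h)
    show ?case using assms(3)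
    proof (induction z rule: S_induct)
      case z: (monom c k)
      show ?case using x y z
        by (simp add: monom_mult_monom twist_closed_mult twist_assoc D_carrier[of k] m_assoc)
    next
      case (add z z')
      then show ?case using x y by (simp add: S_r_distr S_mult_closed monom_closed)
    qed
  next
    case (add y y')
    then show ?case using x assms by (simp add: S_l_distr S_r_distr S_mult_closed monom_closed)
  qed
next
  case (add x x')
  then show ?case using assms by (simp add: S_l_distr S_mult_closed)
qed

sublocale S: rng S
  by (intro rng.intro rng_axioms.intro S_abelian_group)
    (auto simp: S_mult_closed S_assoc S_l_distr S_r_distr)

end

subsection \<open>Invariant ideals and graded simplicity\<close>

context locally_unital_partial_action
begin

lemma S_neg_coeff: "x \<in> carrier S \<Longrightarrow> g \<in> carrier G \<Longrightarrow> (\<ominus>\<^bsub>S\<^esub> x) g = \<ominus>\<^bsub>A\<^esub> x g"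
  using S_add_coeff[of g "\<ominus>\<^bsub>S\<^esub> x" x] S_coeff_A
  by (metis A.minus_equality S.a_inv_closed S.l_neg S_zero_coeff)

text \<open>Monomials span \<open>S\<close> additively, so absorption of arbitrary factors follows
  from absorption of monomials.\<close>

lemma S_ideal_by_monomI:
  assumes "J \<subseteq> carrier S" "\<zero>\<^bsub>S\<^esub> \<in> J"
    and add: "\<And>x y. \<lbrakk>x \<in> J; y \<in> J\<rbrakk> \<Longrightarrow> x \<oplus>\<^bsub>S\<^esub> y \<in> J"
    and left: "\<And>a g x. \<lbrakk>x \<in> J; g \<in> carrier G; a \<in> D g\<rbrakk> \<Longrightarrow> monom a g \<otimes>\<^bsub>S\<^esub> x \<in> J"
    and right: "\<And>a g x. \<lbrakk>x \<in> J; g \<in> carrier G; a \<in> D g\<rbrakk> \<Longrightarrow> x \<otimes>\<^bsub>S\<^esub> monom a g \<in> J"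
    and "\<And>x. x \<in> J \<Longrightarrow> \<ominus>\<^bsub>S\<^esub> x \<in> J"
  shows "rng_ideal J S"
proof (rule S.rng_idealI)
  fix x y assume x: "x \<in> J" and y: "y \<in> carrier S"
  have xS: "x \<in> carrier S" using x assms(1) by blast
  show "y \<otimes>\<^bsub>S\<^esub> x \<in> J" using y
  proof (induction y rule: S_induct)
    case (monom a g)
    then show ?case using left x by blast
  next
    case (add y z)
    then show ?case using assms(3) xS by (simp add: S_l_distr)
  qed
  show "x \<otimes>\<^bsub>S\<^esub> y \<in> J" using y
  proof (induction y rule: S_induct)
    case (monom a g)
    then show ?case using right x by blast
  next
    case (add y z)
    then show ?case using assms(3) xS by (simp add: S_r_distr)
  qed
qed (use assms in auto)

lemma S_ideal_eq_carrierI: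
  assumes "rng_ideal I S" "\<And>a g. g \<in> carrier G \<Longrightarrow> a \<in> D g \<Longrightarrow> monom a g \<in> I"
  shows "I = carrier S"
proof -
  have "x \<in> I" if "x \<in> carrier S" for x
    using that
  proof (induction x rule: S_induct)
    case (add x y)
    then show ?case
      using assms(1) rng_ideal_def additive_subgroup.a_closed by metis
  qed (rule assms(2))
  then show ?thesis using rng_ideal.mem_carrier[OF assms(1)] by blast
qed

text \<open>Coefficients of products with a monomial have the form \<open>twist g a b\<close>. If
  \<open>b\<close> is in \<open>I\<close>, this is \<open>\<alpha> g\<close> of an element of
  \<open>I \<inter> D (inv g)\<close>. If \<open>a\<close> is in \<open>I\<close>, invariance under
  \<open>inv g\<close> first puts \<open>\<alpha> (inv g) a\<close> into \<open>I\<close>, and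
  invariance under \<open>g\<close> then applies as before.\<close>

lemma invariant_ideal_lift:
  assumes I: "rng_ideal I A" and inv: "G_invariant G D \<alpha> I"
  shows "rng_ideal {x \<in> carrier S. \<forall>g\<in>carrier G. x g \<in> I} S" (is "rng_ideal ?J S")
proof -
  interpret I: rng_ideal I A by fact
  have \<alpha>I: "\<alpha> g b \<in> I" if "g \<in> carrier G" "b \<in> I" "b \<in> D (inv g)" for g b
    using inv that unfolding G_invariant_def by blast
  have tI: "twist g a b \<in> I" if "g \<in> carrier G" "a \<in> D g" "b \<in> I" for g a b
  proof -
    have "\<alpha> (inv g) a \<in> D (inv g)" using that \<alpha>_closed' by blast
    then show ?thesis unfolding twist_def
      using that D_mult_right[of "inv g"] I.rng_I_l_closed D_carrier[of "inv g"] I.mem_carrier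
      by (intro \<alpha>I) auto
  qed
  have tI': "twist g a b \<in> I" if "g \<in> carrier G" "a \<in> D g" "a \<in> I" "b \<in> carrier A" for g a b
  proof -
    have "\<alpha> (inv g) a \<in> D (inv g)" "\<alpha> (inv g) a \<in> I" using that \<alpha>_closed' \<alpha>I[of "inv g"] by auto
    then show ?thesis unfolding twist_def
      using that D_mult_right[of "inv g"] I.rng_I_r_closed
      by (intro \<alpha>I) auto
  qed
  show ?thesis
  proof (rule S_ideal_by_monomI)
    fix a g x assume x: "x \<in> ?J" and g: "g \<in> carrier G" and a: "a \<in> D g"
    show "monom a g \<otimes>\<^bsub>S\<^esub> x \<in> ?J"
      using x g a by (auto simp: monom_mult_coeff monom_closed S_mult_closed intro!: tI)
    have "twist (k \<otimes> inv g) (x (k \<otimes> inv g)) a \<in> I" if "k \<in> carrier G" for k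
      using x g that S_coeff D_carrier[OF g a] by (intro tI') auto
    then show "x \<otimes>\<^bsub>S\<^esub> monom a g \<in> ?J"
      using x g a by (auto simp: mult_monom_coeff monom_closed S_mult_closed)
  qed (auto simp: S_neg_coeff)
qed

text \<open>The lift of an invariant ideal \<open>I\<close> to \<open>S\<close> contains
  \<open>monom a \<one>\<close> for exactly the \<open>a\<close> in \<open>I\<close>, so the two
  alternatives for the lift turn into the two alternatives for \<open>I\<close>.\<close>

lemma G_simple_if_simple:
  assumes "simple_rng S"
  shows "G_simple G A D \<alpha>"
proof -
  interpret simple_rng S by fact
  have monom_A: "monom a \<one> \<in> carrier S" if "a \<in> carrier A" for a
    using that by (simp add: monom_closed D_one)
  have "carrier A \<noteq> {\<zero>\<^bsub>A\<^esub>}"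
  proof
    assume A0: "carrier A = {\<zero>\<^bsub>A\<^esub>}"
    have "x = \<zero>\<^bsub>S\<^esub>" if "x \<in> carrier S" for x
      by (rule S_eqI) (use that S_coeff_A[OF that] A0 in auto)
    then show False using simple_nontrivial S.zero_closed by blast
  qed
  moreover have "I = carrier A \<or> I = {\<zero>\<^bsub>A\<^esub>}" if I: "rng_ideal I A" and inv: "G_invariant G D \<alpha> I" for I
  proof -
    interpret I: rng_ideal I A by fact
    let ?J = "{x \<in> carrier S. \<forall>g\<in>carrier G. x g \<in> I}"
    consider "?J = carrier S" | "?J = {\<zero>\<^bsub>S\<^esub>}" using simple_ideals[OF invariant_ideal_lift[OF I inv]] by blast
    then show ?thesis
    proof cases
      case 1
      have "a \<in> I" if "a \<in> carrier A" for a
      proof -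
        have "monom a \<one> \<in> ?J" using monom_A[OF that] unfolding 1 .
        then have "monom a \<one> \<one> \<in> I" by blast
        then show ?thesis by simp
      qed
      then show ?thesis using I.mem_carrier by blast
    next
      case 2
      have "a = \<zero>\<^bsub>A\<^esub>" if "a \<in> I" for a
      proof -
        have "monom a \<one> \<in> ?J" using monom_A I.mem_carrier that by auto
        then have "monom a \<one> = \<zero>\<^bsub>S\<^esub>" unfolding 2 by simp
        then have "monom a \<one> \<one> = \<zero>\<^bsub>S\<^esub> \<one>" by simp
        then show ?thesis by simp
      qed
      then show ?thesis using I.zero_closed by blast
    qed
  qed
  ultimately show ?thesis unfolding G_simple_def by blast
qed

text \<open>\<open>graded_simple N\<close> says that \<open>S\<close>, graded by the cosets of \<open>N\<close>, is graded simple: a graded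
  ideal is generated by its homogeneous elements. For \<open>N = carrier G\<close> this is simplicity.\<close>

definition graded_simple :: "'a set \<Rightarrow> bool"
  where "graded_simple N \<longleftrightarrow> (\<forall>I x g. rng_ideal I S \<longrightarrow> x \<in> I \<longrightarrow> x \<noteq> \<zero>\<^bsub>S\<^esub> \<longrightarrow> g \<in> carrier G \<longrightarrow>
    (\<forall>s\<in>support x. s \<otimes> inv g \<in> N) \<longrightarrow> I = carrier S)"

section \<open>Graded simplicity for the trivial subgroup\<close>

lemma graded_simpleD:
  "\<lbrakk>graded_simple N; rng_ideal I S; x \<in> I; x \<noteq> \<zero>\<^bsub>S\<^esub>; g \<in> carrier G;
    \<And>s. s \<in> support x \<Longrightarrow> s \<otimes> inv g \<in> N\<rbrakk> \<Longrightarrow> I = carrier S"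
  unfolding graded_simple_def by blast

lemma S_nonzeroE:
  assumes "x \<in> carrier S" "x \<noteq> \<zero>\<^bsub>S\<^esub>"
  obtains g where "g \<in> support x"
  using assms S_eqI[OF assms(1) S.zero_closed] by (metis S_zero_coeff supportI)

text \<open>A nonzero homogeneous element is a monomial here. Shifting it to degree
  \<open>\<one>\<close> shows that the ideal \<open>J\<close> of all \<open>b\<close> with
  \<open>monom b \<one>\<close> in \<open>I\<close> is nonzero. As \<open>J\<close> is invariant, it
  equals \<open>A\<close>, and local units then bring every monomial into \<open>I\<close>.\<close>

lemma graded_simple_one:
  assumes "G_simple G A D \<alpha>"
  shows "graded_simple {\<one>}"
  unfolding graded_simple_def
proof (intro allI impI)
  fix I x g assume I: "rng_ideal I S" and x: "x \<in> I" "x \<noteq> \<zero>\<^bsub>S\<^esub>" and g: "g \<in> carrier G"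
    and supp: "\<forall>s\<in>support x. s \<otimes> inv g \<in> {\<one>}"
  interpret I: rng_ideal I S by fact
  have xS: "x \<in> carrier S" using x I.mem_carrier by blast
  have "support x \<subseteq> {g}" using supp g support_carrier[of x] inv_solve_right'[of \<one>] by fastforce
  then have xg: "x = monom (x g) g" "x g \<noteq> \<zero>\<^bsub>A\<^esub>"
  proof -
    show "x = monom (x g) g"
      by (rule S_eqI) (use xS g \<open>support x \<subseteq> {g}\<close> S_coeff monom_closed in \<open>auto simp: supp_def\<close>)
    then show "x g \<noteq> \<zero>\<^bsub>A\<^esub>"
      using S_nonzeroE[OF xS x(2)] \<open>support x \<subseteq> {g}\<close> by (auto simp: supp_def)
  qed
  define J where "J = {b \<in> carrier A. monom b \<one> \<in> I}"
  have m: "monom b \<one> \<in> carrier S" if "b \<in> carrier A" for b using that by (simp add: monom_closed D_one)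
  have mm: "monom b \<one> \<otimes>\<^bsub>S\<^esub> monom c \<one> = monom (b \<otimes>\<^bsub>A\<^esub> c) \<one>"
    if "b \<in> carrier A" "c \<in> carrier A" for b c
    using that by (simp add: monom_mult_monom D_one twist_one)
  have "rng_ideal J A"
  proof (rule A.rng_idealI)
    have "monom \<zero>\<^bsub>A\<^esub> \<one> = \<zero>\<^bsub>S\<^esub>" by (rule S_eqI) (use m in auto)
    then show "\<zero>\<^bsub>A\<^esub> \<in> J" using I.zero_closed by (simp add: J_def)
    fix b assume b: "b \<in> J"
    have "monom (\<ominus>\<^bsub>A\<^esub> b) \<one> = \<ominus>\<^bsub>S\<^esub> monom b \<one>"
      by (rule S_eqI) (use m b in \<open>auto simp: S_neg_coeff J_def\<close>)
    then show "\<ominus>\<^bsub>A\<^esub> b \<in> J" using b by (auto simp: J_def)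
    fix c
    show "b \<oplus>\<^bsub>A\<^esub> c \<in> J" if c: "c \<in> J"
    proof -
      have "monom (b \<oplus>\<^bsub>A\<^esub> c) \<one> = monom b \<one> \<oplus>\<^bsub>S\<^esub> monom c \<one>"
        by (rule S_eqI) (use m b c in \<open>auto simp: J_def\<close>)
      then show ?thesis using b c by (auto simp: J_def)
    qed
    assume c: "c \<in> carrier A"
    show "c \<otimes>\<^bsub>A\<^esub> b \<in> J" "b \<otimes>\<^bsub>A\<^esub> c \<in> J"
      using b c I.rng_I_l_closed[OF _ m[OF c], of "monom b \<one>"] I.rng_I_r_closed[OF _ m[OF c], of "monom b \<one>"]
      by (auto simp: J_def mm A.rng_m_closed)
  qed (auto simp: J_def)
  moreover have "G_invariant G D \<alpha> J"
    unfolding G_invariant_def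
  proof (intro ballI subsetI)
    fix k a assume k: "k \<in> carrier G" and "a \<in> \<alpha> k ` (J \<inter> D (inv k))"
    then obtain b where b: "b \<in> J" "b \<in> D (inv k)" "a = \<alpha> k b" by blast
    \<comment> \<open>With \<open>u\<close> acting as a unit on \<open>b\<close>, the element
      \<open>\<alpha> k b\<close> in degree \<open>\<one>\<close> is the product of
      \<open>monom (\<alpha> k u) k\<close>, \<open>monom b \<one>\<close> and
      \<open>monom u (inv k)\<close>.\<close>
    obtain u where u: "u \<in> D (inv k)" "u \<otimes>\<^bsub>A\<^esub> b = b" "b \<otimes>\<^bsub>A\<^esub> u = b"
      using local_unit[of "inv k" "{b}"] k b by auto
    have bA: "b \<in> carrier A" and bI: "monom b \<one> \<in> I" using b by (auto simp: J_def)
    have ku: "\<alpha> k u \<in> D k" "\<alpha> k b \<in> D k" using k u b \<alpha>_closed by auto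
    have "monom (\<alpha> k u) k \<otimes>\<^bsub>S\<^esub> monom b \<one> = monom (\<alpha> k b) k"
      using ku k bA u by (simp add: monom_mult_monom D_one twist_def \<alpha>_inverse')
    moreover have "monom (\<alpha> k b) k \<otimes>\<^bsub>S\<^esub> monom u (inv k) = monom (\<alpha> k b) \<one>"
      using ku k u b by (simp add: monom_mult_monom twist_def \<alpha>_inverse')
    ultimately have "monom (\<alpha> k b) \<one> \<in> I"
      using I.rng_I_l_closed[OF bI monom_closed[OF k ku(1)]]
        I.rng_I_r_closed[OF _ monom_closed[of "inv k" u]] k u by fastforce
    then show "a \<in> J" using b ku D_carrier k by (auto simp: J_def)
  qed
  moreover have "x g \<in> J"
  proof -
    have xgD: "x g \<in> D g" using xS g S_coeff by blast
    \<comment> \<open>A local unit \<open>u\<close> for \<open>x g\<close> yields a factor of degree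
      \<open>inv g\<close>, namely \<open>\<alpha> (inv g) u\<close>, that shifts \<open>x g\<close>
      to degree \<open>\<one>\<close> without changing it.\<close>
    obtain u where u: "u \<in> D g" "x g \<otimes>\<^bsub>A\<^esub> u = x g" using local_unit[of g "{x g}"] g xgD by auto
    have "monom (x g) g \<otimes>\<^bsub>S\<^esub> monom (\<alpha> (inv g) u) (inv g) = monom (x g) \<one>"
      using u xgD g \<alpha>_closed' \<alpha>_mult[of "inv g" "x g" u, symmetric]
      by (simp add: monom_mult_monom twist_def \<alpha>_inverse)
    moreover have "monom (x g) g \<otimes>\<^bsub>S\<^esub> monom (\<alpha> (inv g) u) (inv g) \<in> I"
      using I.rng_I_r_closed[OF x(1)] xg(1) monom_closed[of "inv g" "\<alpha> (inv g) u"] g u \<alpha>_closed' by auto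
    ultimately show ?thesis using xgD D_carrier g by (auto simp: J_def)
  qed
  ultimately have JA: "J = carrier A" using assms xg(2) unfolding G_simple_def by blast
  show "I = carrier S"
  proof (rule S_ideal_eq_carrierI[OF I])
    fix a k assume k: "k \<in> carrier G" and a: "a \<in> D k"
    obtain u where u: "u \<in> D k" "u \<otimes>\<^bsub>A\<^esub> a = a" using local_unit[of k "{a}"] k a by auto
    have uA: "u \<in> carrier A" "a \<in> carrier A" using u k a D_carrier by auto
    have "monom u \<one> \<otimes>\<^bsub>S\<^esub> monom a k = monom a k"
      using uA u k a by (simp add: monom_mult_monom D_one twist_one)
    moreover have "monom u \<one> \<in> I" using uA JA by (auto simp: J_def)
    ultimately show "monom a k \<in> I" using I.rng_I_r_closed monom_closed[OF k a] by metis
  qed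
qed

end

subsection \<open>Preimages of centers of factor groups\<close>

lemma (in group) mult_inv_cancel:
  assumes "x \<in> carrier G" "y \<in> carrier G"
  shows "x \<otimes> (inv x \<otimes> y) = y" "inv x \<otimes> (x \<otimes> y) = y"
  using assms by (simp_all flip: m_assoc)

text \<open>The preimage in \<open>G\<close> of the center of \<open>G Mod N\<close>.\<close>

definition (in group) center_mod :: "'a set \<Rightarrow> 'a set"
  where "center_mod N = {z \<in> carrier G. \<forall>g\<in>carrier G. g \<otimes> z \<otimes> inv g \<otimes> inv z \<in> N}"

context normal
begin

lemma center_mod_superset: "H \<subseteq> center_mod H"
proof
  fix n assume n: "n \<in> H"
  then have "g \<otimes> n \<otimes> inv g \<otimes> inv n \<in> H" if "g \<in> carrier G" for g
    using subgroup.m_closed[OF is_subgroup inv_op_closed2[OF that n]]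
      subgroup.m_inv_closed[OF is_subgroup n] by blast
  then show "n \<in> center_mod H" using n mem_carrier by (auto simp: center_mod_def)
qed

text \<open>With \<open>[g, z] = g z g^-1 z^-1\<close>, closure under inverses and products follows
  from \<open>[g, z^-1] = z^-1 [g, z]^-1 z\<close> and
  \<open>[g, z w] = [g, z] (z [g, w] z^-1)\<close>, as \<open>H\<close> is normal. Conjugates are
  covered by \<open>x z x^-1 = [x, z] z\<close>, where \<open>[x, z]\<close> lies in
  \<open>H\<close> and hence in \<open>center_mod H\<close>.\<close>

lemma center_mod_normal: "center_mod H \<lhd> G"
proof -
  have "subgroup (center_mod H) G"
  proof (rule subgroupI)
    show "center_mod H \<noteq> {}" using center_mod_superset subgroup.one_closed[OF is_subgroup] by blast
    fix z assume z: "z \<in> center_mod H"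
    then have zG: "z \<in> carrier G" and zH: "\<And>g. g \<in> carrier G \<Longrightarrow> g \<otimes> z \<otimes> inv g \<otimes> inv z \<in> H"
      by (auto simp: center_mod_def)
    have "g \<otimes> inv z \<otimes> inv g \<otimes> inv (inv z) \<in> H" if g: "g \<in> carrier G" for g
    proof -
      have "inv z \<otimes> inv (g \<otimes> z \<otimes> inv g \<otimes> inv z) \<otimes> z \<in> H"
        using inv_op_closed1[OF zG] zH[OF g] by blast
      moreover have "inv z \<otimes> inv (g \<otimes> z \<otimes> inv g \<otimes> inv z) \<otimes> z = g \<otimes> inv z \<otimes> inv g \<otimes> inv (inv z)"
        using zG g by (simp add: inv_mult_group m_assoc mult_inv_cancel)
      ultimately show ?thesis by simp
    qed
    then show "inv z \<in> center_mod H" using zG by (simp add: center_mod_def)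
    fix w assume w: "w \<in> center_mod H"
    then have wG: "w \<in> carrier G" and wH: "\<And>g. g \<in> carrier G \<Longrightarrow> g \<otimes> w \<otimes> inv g \<otimes> inv w \<in> H"
      by (auto simp: center_mod_def)
    have "g \<otimes> (z \<otimes> w) \<otimes> inv g \<otimes> inv (z \<otimes> w) \<in> H" if g: "g \<in> carrier G" for g
    proof -
      have "g \<otimes> z \<otimes> inv g \<otimes> inv z \<otimes> (z \<otimes> (g \<otimes> w \<otimes> inv g \<otimes> inv w) \<otimes> inv z) \<in> H"
        using inv_op_closed2[OF zG wH[OF g]] zH[OF g] by blast
      moreover have "g \<otimes> z \<otimes> inv g \<otimes> inv z \<otimes> (z \<otimes> (g \<otimes> w \<otimes> inv g \<otimes> inv w) \<otimes> inv z) =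
          g \<otimes> (z \<otimes> w) \<otimes> inv g \<otimes> inv (z \<otimes> w)"
        using zG wG g by (simp add: inv_mult_group m_assoc mult_inv_cancel)
      ultimately show ?thesis by simp
    qed
    then show "z \<otimes> w \<in> center_mod H" using zG wG by (simp add: center_mod_def)
  qed (auto simp: center_mod_def)
  moreover have "x \<otimes> z \<otimes> inv x \<in> center_mod H" if x: "x \<in> carrier G" and z: "z \<in> center_mod H" for x z
  proof -
    have zG: "z \<in> carrier G" using z by (simp add: center_mod_def)
    have "x \<otimes> z \<otimes> inv x \<otimes> inv z \<in> center_mod H" using x z center_mod_superset by (auto simp: center_mod_def)
    then have "x \<otimes> z \<otimes> inv x \<otimes> inv z \<otimes> z \<in> center_mod H"
      using subgroup.m_closed[OF calculation _ z] by blast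
    then show ?thesis using x zG by (simp add: m_assoc)
  qed
  ultimately show ?thesis by (simp add: normal_inv_iff)
qed

lemma center_mod_proper:
  assumes "center (G Mod H) \<noteq> {\<one>\<^bsub>G Mod H\<^esub>}"
  shows "center_mod H \<noteq> H"
proof -
  have c_iff: "H #> z \<in> center (G Mod H) \<longleftrightarrow> (\<forall>g\<in>carrier G. H #> (z \<otimes> g) = H #> (g \<otimes> z))"
    if "z \<in> carrier G" for z
    using that by (auto simp: center_def carrier_FactGroup rcos_sum)
  \<comment> \<open>The identity coset is central, so a center different from the trivial one must
    contain a further coset.\<close>
  have "H \<in> center (G Mod H)"
    using c_iff[of \<one>] subset by (simp add: coset_mult_one)
  then obtain C where C: "C \<in> center (G Mod H)" "C \<noteq> H" using assms by auto
  then obtain z where z: "z \<in> carrier G" "C = H #> z" by (auto simp: center_def carrier_FactGroup)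
  have "g \<otimes> z \<otimes> inv g \<otimes> inv z \<in> H" if g: "g \<in> carrier G" for g
  proof -
    have "H #> (g \<otimes> z) = H #> (z \<otimes> g)" using C z c_iff g by simp
    then have "g \<otimes> z \<otimes> inv (z \<otimes> g) \<in> H"
      using coset_mult_inv2 coset_join1 g z subset is_subgroup by (metis inv_closed m_closed)
    then show ?thesis using g z by (simp add: inv_mult_group m_assoc)
  qed
  then have "z \<in> center_mod H" using z by (simp add: center_mod_def)
  moreover have "z \<notin> H" using C z rcos_const[OF is_group] by blast
  ultimately show ?thesis by blast
qed

end

lemma (in group) normal_Union_chain:
  assumes "\<C> \<noteq> {}" "subset.chain {N. N \<lhd> G} \<C>"
  shows "\<Union>\<C> \<lhd> G"
proof -
  have N: "subgroup N G" "x \<in> carrier G \<Longrightarrow> h \<in> N \<Longrightarrow> x \<otimes> h \<otimes> inv x \<in> N" if "N \<in> \<C>" for N x h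
    using that assms(2) normal_inv_iff by (auto simp: subset.chain_def)
  have "subgroup (\<Union>\<C>) G"
  proof (rule subgroupI)
    show "\<Union>\<C> \<subseteq> carrier G" using subgroup.subset[OF N(1)] by blast
    show "\<Union>\<C> \<noteq> {}" using assms(1) subgroup.one_closed[OF N(1)] by blast
    fix a assume a: "a \<in> \<Union>\<C>"
    then obtain M where "M \<in> \<C>" "a \<in> M" by blast
    then show "inv a \<in> \<Union>\<C>" using subgroup.m_inv_closed[OF N(1)] by blast
    fix b assume b: "b \<in> \<Union>\<C>"
    obtain N where "N \<in> \<C>" "{a, b} \<subseteq> N"
      using finite_subset_Union_chain[of "{a, b}" \<C>] a b assms by auto
    then show "a \<otimes> b \<in> \<Union>\<C>" using subgroup.m_closed[OF N(1)] by blast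
  qed
  then show ?thesis using N(2) by (auto simp: normal_inv_iff)
qed

subsection \<open>Ascent along the upper central series\<close>

context locally_unital_partial_action
begin

lemma graded_simple_Union_chain:
  assumes "\<C> \<noteq> {}" "subset.chain {N. N \<lhd> G \<and> graded_simple N} \<C>"
  shows "graded_simple (\<Union>\<C>)"
  unfolding graded_simple_def
proof (intro allI impI)
  fix I x g assume I: "rng_ideal I S" and x: "x \<in> I" "x \<noteq> \<zero>\<^bsub>S\<^esub>" and g: "g \<in> carrier G"
    and supp: "\<forall>s\<in>support x. s \<otimes> inv g \<in> \<Union>\<C>"
  have "finite (support x)" using support_finite rng_ideal.mem_carrier[OF I x(1)] .
  then obtain N where N: "N \<in> \<C>" "(\<lambda>s. s \<otimes> inv g) ` support x \<subseteq> N"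
    using finite_subset_Union_chain[of "(\<lambda>s. s \<otimes> inv g) ` support x" \<C>] supp assms by blast
  then have "graded_simple N" using assms(2) by (auto simp: subset.chain_def)
  then show "I = carrier S" using graded_simpleD I x g N by blast
qed

lemma monom_one_idem:
  "f \<in> carrier A \<Longrightarrow> f \<otimes>\<^bsub>A\<^esub> f = f \<Longrightarrow> monom f \<one> \<otimes>\<^bsub>S\<^esub> monom f \<one> = monom f \<one>"
  by (simp add: monom_mult_monom D_one twist_one)

text \<open>The two graded simplicity assumptions serve different ideals: \<open>gs\<close> is
  applied to an auxiliary ideal \<open>J\<close> and provides an element of \<open>I\<close> with
  prescribed \<open>N\<close>-component, while \<open>gs1\<close> is applied to \<open>I\<close>
  itself once \<open>monom f \<one>\<close> lies in it. In between, the field assumption inverts a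
  central element of the corner.\<close>

lemma graded_simple_center_mod:
  assumes N: "N \<lhd> G" and gs: "graded_simple N" and gs1: "graded_simple {\<one>}"
    and f: "f \<in> carrier A" "f \<otimes>\<^bsub>A\<^esub> f = f" "f \<noteq> \<zero>\<^bsub>A\<^esub>"
    and fld: "field (center_ring (corner S (monom f \<one>)))"
  shows "graded_simple (center_mod N)"
  unfolding graded_simple_def
proof (intro allI impI, rule ccontr)
  interpret N: normal N G by fact
  let ?Z = "center_mod N" and ?\<phi> = "monom f \<one>"
  fix I x0 g0
  assume I: "rng_ideal I S" and x0: "x0 \<in> I" "x0 \<noteq> \<zero>\<^bsub>S\<^esub>" "g0 \<in> carrier G"
    "\<forall>s\<in>support x0. s \<otimes> inv g0 \<in> ?Z" and I_ne: "I \<noteq> carrier S"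
  interpret I: rng_ideal I S by fact
  define num where "num x = card ((\<lambda>s. N #> s) ` support x)" for x
  let ?P = "\<lambda>x. x \<in> I \<and> x \<noteq> \<zero>\<^bsub>S\<^esub> \<and> (\<exists>g\<in>carrier G. \<forall>s\<in>support x. s \<otimes> inv g \<in> ?Z)"
  obtain x where "?P x" and min: "\<And>y. ?P y \<Longrightarrow> num x \<le> num y"
    using ex_has_least_nat[of ?P x0 num] x0 by blast
  then obtain g where x: "x \<in> I" "x \<noteq> \<zero>\<^bsub>S\<^esub>" and g: "g \<in> carrier G" "\<And>s. s \<in> support x \<Longrightarrow> s \<otimes> inv g \<in> ?Z"
    by blast
  note N_mult = subgroup.m_closed[OF N.is_subgroup] and N_inv = subgroup.m_inv_closed[OF N.is_subgroup]
  have N_one: "\<one> \<in> N" using subgroup.one_closed[OF N.is_subgroup] .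
  have Z: "subgroup ?Z G" using N.center_mod_normal normal_imp_subgroup by blast
  have xS: "x \<in> carrier S" using x I.mem_carrier by blast
  obtain h where h: "h \<in> support x" using S_nonzeroE[OF xS x(2)] .
  have hG: "h \<in> carrier G" using h support_carrier by blast
  have coset_iff: "N #> s = N #> t \<longleftrightarrow> s \<otimes> inv t \<in> N" if "s \<in> carrier G" "t \<in> carrier G" for s t
    using that coset_mult_inv1[of N s t] coset_mult_inv2[of N s t] coset_join1[of N "s \<otimes> inv t"]
      coset_join2[of "s \<otimes> inv t" N] N.is_subgroup N.subset by (metis inv_closed m_closed)

  \<comment> \<open>\<open>U\<close> is the union of the cosets of \<open>t \<otimes> inv h\<close>
    modulo \<open>N\<close>, for \<open>t\<close> in the support of \<open>x\<close>: the degrees of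
    \<open>x\<close>, shifted so that the coset of \<open>h\<close> becomes \<open>N\<close>. It
    lies in \<open>center_mod N\<close>, and since this is central modulo \<open>N\<close>,
    conjugation by any element of \<open>G\<close> preserves \<open>U\<close>.\<close>
  define U where "U = {u \<in> carrier G. \<exists>t\<in>support x. u \<otimes> h \<otimes> inv t \<in> N}"
  have U_Z: "u \<in> ?Z" if u: "u \<in> U" for u
  proof -
    obtain t where t: "t \<in> support x" "u \<otimes> h \<otimes> inv t \<in> N" and uG: "u \<in> carrier G" using u by (auto simp: U_def)
    have tG: "t \<in> carrier G" using t support_carrier by blast
    have "t \<otimes> inv g \<otimes> inv (h \<otimes> inv g) \<in> ?Z"
      using subgroup.m_closed[OF Z g(2)[OF t(1)] subgroup.m_inv_closed[OF Z g(2)[OF h]]] .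
    then have "(u \<otimes> h \<otimes> inv t) \<otimes> (t \<otimes> inv g \<otimes> inv (h \<otimes> inv g)) \<in> ?Z"
      using subgroup.m_closed[OF Z] t(2) N.center_mod_superset by (meson subsetD)
    moreover have "(u \<otimes> h \<otimes> inv t) \<otimes> (t \<otimes> inv g \<otimes> inv (h \<otimes> inv g)) = u"
      using uG hG tG g(1) by (simp add: inv_mult_group m_assoc mult_inv_cancel)
    ultimately show ?thesis by simp
  qed
  have U_conj: "d \<otimes> u \<otimes> inv d \<in> U" if u: "u \<in> U" and d: "d \<in> carrier G" for u d
  proof -
    obtain t where t: "t \<in> support x" "u \<otimes> h \<otimes> inv t \<in> N" and uG: "u \<in> carrier G" using u by (auto simp: U_def)
    have tG: "t \<in> carrier G" using t support_carrier by blast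
    have "d \<otimes> u \<otimes> inv d \<otimes> inv u \<in> N" using U_Z[OF u] d by (simp add: center_mod_def)
    then have "(d \<otimes> u \<otimes> inv d \<otimes> inv u) \<otimes> (u \<otimes> h \<otimes> inv t) \<in> N" using N_mult[OF _ t(2)] by simp
    moreover have "(d \<otimes> u \<otimes> inv d \<otimes> inv u) \<otimes> (u \<otimes> h \<otimes> inv t) = d \<otimes> u \<otimes> inv d \<otimes> h \<otimes> inv t"
      using uG hG tG d by (simp add: m_assoc mult_inv_cancel)
    ultimately show ?thesis using t(1) uG d by (auto simp: U_def)
  qed

  text \<open>Elements of \<open>J\<close> are those whose \<open>N\<close>-homogeneous components all come from elements of \<open>I\<close>
    whose supports meet no more \<open>N\<close>-cosets than that of \<open>x\<close>. As \<open>J\<close> contains the component of \<open>x\<close> at \<open>h\<close>, it is all of \<open>S\<close>.\<close>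
  define J where "J = {w \<in> carrier S. \<forall>k\<in>carrier G. \<exists>y\<in>I.
    (\<forall>s\<in>support y. s \<otimes> inv k \<in> U) \<and> (\<forall>s\<in>carrier G. s \<otimes> inv k \<in> N \<longrightarrow> y s = w s)}"
  have "rng_ideal J S"
  proof (rule S_ideal_by_monomI)
    show "J \<subseteq> carrier S" by (auto simp: J_def)
    have "support \<zero>\<^bsub>S\<^esub> = {}" by (auto simp: supp_def)
    then show "\<zero>\<^bsub>S\<^esub> \<in> J" by (auto simp: J_def intro!: bexI[of _ "\<zero>\<^bsub>S\<^esub>"])
    fix w assume w: "w \<in> J"
    then have wS: "w \<in> carrier S" by (simp add: J_def)
    have wE: "\<exists>y\<in>I. (\<forall>s\<in>support y. s \<otimes> inv k \<in> U) \<and> (\<forall>s\<in>carrier G. s \<otimes> inv k \<in> N \<longrightarrow> y s = w s)"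
      if "k \<in> carrier G" for k using w that by (simp add: J_def)
    have "\<exists>y\<in>I. (\<forall>s\<in>support y. s \<otimes> inv k \<in> U) \<and>
        (\<forall>s\<in>carrier G. s \<otimes> inv k \<in> N \<longrightarrow> y s = (\<ominus>\<^bsub>S\<^esub> w) s)" if k: "k \<in> carrier G" for k
    proof -
      obtain y where y: "y \<in> I" "\<forall>s\<in>support y. s \<otimes> inv k \<in> U"
        "\<forall>s\<in>carrier G. s \<otimes> inv k \<in> N \<longrightarrow> y s = w s" using wE[OF k] by blast
      have yS: "y \<in> carrier S" using y I.mem_carrier by blast
      have "support (\<ominus>\<^bsub>S\<^esub> y) \<subseteq> support y"
        using yS by (auto simp: supp_def S_neg_coeff)
      then show ?thesis using y yS wS by (intro bexI[of _ "\<ominus>\<^bsub>S\<^esub> y"]) (auto simp: S_neg_coeff)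
    qed
    then show "\<ominus>\<^bsub>S\<^esub> w \<in> J" using wS by (simp add: J_def)
    show "w \<oplus>\<^bsub>S\<^esub> v \<in> J" if v: "v \<in> J" for v
    proof -
      have vS: "v \<in> carrier S" using v by (simp add: J_def)
      have "\<exists>y\<in>I. (\<forall>s\<in>support y. s \<otimes> inv k \<in> U) \<and>
          (\<forall>s\<in>carrier G. s \<otimes> inv k \<in> N \<longrightarrow> y s = (w \<oplus>\<^bsub>S\<^esub> v) s)" if k: "k \<in> carrier G" for k
      proof -
        obtain y where y: "y \<in> I" "\<forall>s\<in>support y. s \<otimes> inv k \<in> U"
          "\<forall>s\<in>carrier G. s \<otimes> inv k \<in> N \<longrightarrow> y s = w s" using wE[OF k] by blast
        obtain z where z: "z \<in> I" "\<forall>s\<in>support z. s \<otimes> inv k \<in> U"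
          "\<forall>s\<in>carrier G. s \<otimes> inv k \<in> N \<longrightarrow> z s = v s" using v k by (auto simp: J_def)
        have "support (y \<oplus>\<^bsub>S\<^esub> z) \<subseteq> support y \<union> support z" by (auto simp: supp_def)
        then show ?thesis using y z by (intro bexI[of _ "y \<oplus>\<^bsub>S\<^esub> z"]) auto
      qed
      then show ?thesis using wS vS by (simp add: J_def)
    qed
    fix a d assume d: "d \<in> carrier G" and a: "a \<in> D d"
    have m: "monom a d \<in> carrier S" using d a monom_closed by blast
    have aA: "a \<in> carrier A" using d a D_carrier by blast
    have "\<exists>y\<in>I. (\<forall>s\<in>support y. s \<otimes> inv k \<in> U) \<and>
        (\<forall>s\<in>carrier G. s \<otimes> inv k \<in> N \<longrightarrow> y s = (monom a d \<otimes>\<^bsub>S\<^esub> w) s)" if k: "k \<in> carrier G" for k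
    proof -
      \<comment> \<open>The component of the product at \<open>k\<close> comes from that of
        \<open>w\<close> at \<open>inv d \<otimes> k\<close>. Passing from \<open>y\<close> to the
        product conjugates the degree relative to these base points by \<open>d\<close>, which
        \<open>U_conj\<close> permits. For multiplication on the right, treated next, the relative
        degree does not change.\<close>
      have k': "inv d \<otimes> k \<in> carrier G" using d k by simp
      obtain y where y: "y \<in> I" "\<forall>s\<in>support y. s \<otimes> inv (inv d \<otimes> k) \<in> U"
        "\<forall>s\<in>carrier G. s \<otimes> inv (inv d \<otimes> k) \<in> N \<longrightarrow> y s = w s" using wE[OF k'] by blast
      have yS: "y \<in> carrier S" using y I.mem_carrier by blast
      have conj: "d \<otimes> (inv d \<otimes> s \<otimes> inv (inv d \<otimes> k)) \<otimes> inv d = s \<otimes> inv k"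
        "inv d \<otimes> s \<otimes> inv (inv d \<otimes> k) = inv d \<otimes> (s \<otimes> inv k) \<otimes> d" if "s \<in> carrier G" for s
        using that d k by (simp_all add: inv_mult_group m_assoc mult_inv_cancel)
      have "s \<otimes> inv k \<in> U" if s: "s \<in> support (monom a d \<otimes>\<^bsub>S\<^esub> y)" for s
      proof -
        have sG: "s \<in> carrier G" using s support_carrier by blast
        then have "y (inv d \<otimes> s) \<noteq> \<zero>\<^bsub>A\<^esub>"
          using s d a yS by (auto simp: supp_def monom_mult_coeff)
        then have "inv d \<otimes> s \<otimes> inv (inv d \<otimes> k) \<in> U" using y(2) sG d by (simp add: supportI)
        then show ?thesis using U_conj[OF _ d] conj(1)[OF sG] by metis
      qed
      moreover have "(monom a d \<otimes>\<^bsub>S\<^esub> y) s = (monom a d \<otimes>\<^bsub>S\<^esub> w) s"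
        if s: "s \<in> carrier G" "s \<otimes> inv k \<in> N" for s
        using y(3) N.inv_op_closed1[OF d s(2)] conj(2)[OF s(1)] s d a yS wS by (simp add: monom_mult_coeff)
      ultimately show ?thesis using I.rng_I_l_closed[OF y(1) m] by blast
    qed
    then show "monom a d \<otimes>\<^bsub>S\<^esub> w \<in> J" using wS m by (simp add: J_def S_mult_closed)
    have "\<exists>y\<in>I. (\<forall>s\<in>support y. s \<otimes> inv k \<in> U) \<and>
        (\<forall>s\<in>carrier G. s \<otimes> inv k \<in> N \<longrightarrow> y s = (w \<otimes>\<^bsub>S\<^esub> monom a d) s)" if k: "k \<in> carrier G" for k
    proof -
      have k': "k \<otimes> inv d \<in> carrier G" using d k by simp
      obtain y where y: "y \<in> I" "\<forall>s\<in>support y. s \<otimes> inv (k \<otimes> inv d) \<in> U"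
        "\<forall>s\<in>carrier G. s \<otimes> inv (k \<otimes> inv d) \<in> N \<longrightarrow> y s = w s" using wE[OF k'] by blast
      have yS: "y \<in> carrier S" using y I.mem_carrier by blast
      have conj: "s \<otimes> inv d \<otimes> inv (k \<otimes> inv d) = s \<otimes> inv k" if "s \<in> carrier G" for s
        using that d k by (simp add: inv_mult_group m_assoc mult_inv_cancel)
      have "s \<otimes> inv k \<in> U" if s: "s \<in> support (y \<otimes>\<^bsub>S\<^esub> monom a d)" for s
      proof -
        have sG: "s \<in> carrier G" using s support_carrier by blast
        then have "y (s \<otimes> inv d) \<noteq> \<zero>\<^bsub>A\<^esub>"
          using s d a aA yS by (auto simp: supp_def mult_monom_coeff)
        then have "s \<otimes> inv d \<otimes> inv (k \<otimes> inv d) \<in> U" using y(2) sG d by (simp add: supportI)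
        then show ?thesis using conj[OF sG] by metis
      qed
      moreover have "(y \<otimes>\<^bsub>S\<^esub> monom a d) s = (w \<otimes>\<^bsub>S\<^esub> monom a d) s"
        if s: "s \<in> carrier G" "s \<otimes> inv k \<in> N" for s
        using y(3) conj[OF s(1)] s d a yS wS by (simp add: mult_monom_coeff)
      ultimately show ?thesis using I.rng_I_r_closed[OF y(1) m] by blast
    qed
    then show "w \<otimes>\<^bsub>S\<^esub> monom a d \<in> J" using wS m by (simp add: J_def S_mult_closed)
  qed
  \<comment> \<open>The \<open>N\<close>-component of \<open>x\<close> at \<open>h\<close>. It is
    nonzero because \<open>h\<close> lies in the support of \<open>x\<close>.\<close>
  moreover define xh where "xh = (\<lambda>k\<in>carrier G. if k \<otimes> inv h \<in> N then x k else \<zero>\<^bsub>A\<^esub>)"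
  have xh_supp: "support xh \<subseteq> support x" "\<And>s. s \<in> support xh \<Longrightarrow> s \<otimes> inv h \<in> N"
    by (auto simp: supp_def xh_def split: if_splits)
  have xhS: "xh \<in> carrier S"
    unfolding S_carrier_iff
    using xS S_coeff finite_subset[OF xh_supp(1) support_finite[OF xS]] by (auto simp: xh_def)
  have xh_ne: "xh \<noteq> \<zero>\<^bsub>S\<^esub>"
  proof
    assume "xh = \<zero>\<^bsub>S\<^esub>"
    then have "xh h = \<zero>\<^bsub>S\<^esub> h" by simp
    then show False using h hG N_one by (auto simp: xh_def supp_def)
  qed
  moreover have "xh \<in> J"
  proof -
    have "\<exists>y\<in>I. (\<forall>s\<in>support y. s \<otimes> inv k \<in> U) \<and> (\<forall>s\<in>carrier G. s \<otimes> inv k \<in> N \<longrightarrow> y s = xh s)"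
      if k: "k \<in> carrier G" for k
    \<comment> \<open>If \<open>k\<close> is in the coset of \<open>h\<close>, then \<open>x\<close>
      itself is a witness, by the choice of \<open>U\<close>. Otherwise \<open>xh\<close> vanishes
      on the coset of \<open>k\<close>, and zero is a witness.\<close>
    proof (cases "k \<otimes> inv h \<in> N")
      case True
      have "s \<otimes> inv k \<in> U" if s: "s \<in> support x" for s
      proof -
        have sG: "s \<in> carrier G" using s support_carrier by blast
        have "s \<otimes> (inv h \<otimes> inv (k \<otimes> inv h) \<otimes> h) \<otimes> inv s \<in> N"
          using N.inv_op_closed2[OF sG N.inv_op_closed1[OF hG N_inv[OF True]]] .
        then have "s \<otimes> inv k \<otimes> h \<otimes> inv s \<in> N" using sG hG k by (simp add: inv_mult_group m_assoc mult_inv_cancel)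
        then show ?thesis using s sG k by (auto simp: U_def)
      qed
      moreover have "x s = xh s" if s: "s \<in> carrier G" "s \<otimes> inv k \<in> N" for s
      proof -
        have "(s \<otimes> inv k) \<otimes> (k \<otimes> inv h) \<in> N" using N_mult[OF s(2) True] .
        then have "s \<otimes> inv h \<in> N" using s k hG by (simp add: m_assoc mult_inv_cancel)
        then show ?thesis using s by (simp add: xh_def)
      qed
      ultimately show ?thesis using x by blast
    next
      case False
      have "xh s = \<zero>\<^bsub>A\<^esub>" if s: "s \<in> carrier G" "s \<otimes> inv k \<in> N" for s
      proof -
        have "s \<otimes> inv h \<notin> N"
        proof
          assume "s \<otimes> inv h \<in> N"
          then have "inv (s \<otimes> inv k) \<otimes> (s \<otimes> inv h) \<in> N" using N_mult[OF N_inv[OF s(2)]] by simp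
          then show False using False s k hG by (simp add: inv_mult_group m_assoc mult_inv_cancel)
        qed
        then show ?thesis using s by (simp add: xh_def)
      qed
      moreover have "support \<zero>\<^bsub>S\<^esub> = {}" by (auto simp: supp_def)
      ultimately show ?thesis by (intro bexI[of _ "\<zero>\<^bsub>S\<^esub>"]) auto
    qed
    then show ?thesis using xhS by (simp add: J_def)
  qed
  ultimately have J: "J = carrier S" using graded_simpleD[OF gs _ _ _ hG] xh_supp(2) by blast

  have \<phi>S: "?\<phi> \<in> carrier S" using f by (simp add: monom_closed D_one)
  have \<phi>\<phi>: "?\<phi> \<otimes>\<^bsub>S\<^esub> ?\<phi> = ?\<phi>" using f monom_one_idem by blast
  have \<phi>_left: "(?\<phi> \<otimes>\<^bsub>S\<^esub> w) k = twist \<one> f (w k)"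
    and \<phi>_right: "(w \<otimes>\<^bsub>S\<^esub> ?\<phi>) k = twist k (w k) f" if "w \<in> carrier S" "k \<in> carrier G" for w k
    using that f by (simp_all add: monom_mult_coeff mult_monom_coeff D_one)
  \<comment> \<open>Membership of \<open>?\<phi>\<close> in \<open>J\<close> is evaluated at
    \<open>k = \<one>\<close>, so the relative degrees become the degrees themselves.\<close>
  obtain y0 where y0: "y0 \<in> I" "\<forall>s\<in>support y0. s \<in> U" "\<forall>s\<in>N. y0 s = ?\<phi> s"
  proof -
    have "?\<phi> \<in> J" using \<phi>S J by simp
    then obtain y where y: "y \<in> I" "\<forall>s\<in>support y. s \<otimes> inv \<one> \<in> U" "\<forall>s\<in>carrier G. s \<otimes> inv \<one> \<in> N \<longrightarrow> y s = ?\<phi> s"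
      using one_closed unfolding J_def by blast
    have "\<forall>s\<in>support y. s \<in> U" using y(2) support_carrier[of y] by (auto simp: subset_iff)
    moreover have "\<forall>s\<in>N. y s = ?\<phi> s" using y(3) N.mem_carrier by auto
    ultimately show ?thesis using that y(1) by blast
  qed
  have y0S: "y0 \<in> carrier S" using y0 I.mem_carrier by blast
  \<comment> \<open>Compression to the corner. Multiplying by \<open>?\<phi>\<close>, which has
    degree \<open>\<one>\<close>, acts on each coefficient separately, so the support does not grow;
    the \<open>N\<close>-component \<open>?\<phi>\<close> is kept because \<open>?\<phi>\<close> is
    idempotent.\<close>
  define y where "y = ?\<phi> \<otimes>\<^bsub>S\<^esub> y0 \<otimes>\<^bsub>S\<^esub> ?\<phi>"
  have yI: "y \<in> I" using y0 \<phi>S I.rng_I_l_closed I.rng_I_r_closed by (simp add: y_def)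
  have yS: "y \<in> carrier S" using yI I.mem_carrier by blast
  have y_coeff: "y s = twist s (twist \<one> f (y0 s)) f" if "s \<in> carrier G" for s
    using that \<phi>S y0S by (simp add: y_def \<phi>_left \<phi>_right S_mult_closed)
  have yU: "s \<in> U" if s: "s \<in> support y" for s
  proof -
    have "s \<in> carrier G" "y s \<noteq> \<zero>\<^bsub>A\<^esub>" using s by (auto simp: supp_def)
    then have "y0 s \<noteq> \<zero>\<^bsub>A\<^esub>" using y_coeff f by (force simp: D_one)
    then show ?thesis using y0(2) \<open>s \<in> carrier G\<close> by (simp add: supportI)
  qed
  have yN: "y s = ?\<phi> s" if s: "s \<in> N" for s
  proof -
    have sG: "s \<in> carrier G" using s N.mem_carrier by blast
    have "y s = twist s ((?\<phi> \<otimes>\<^bsub>S\<^esub> ?\<phi>) s) f"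
      using s y0(3) y_coeff[OF sG] \<phi>_left[OF \<phi>S sG] by simp
    also have "\<dots> = (?\<phi> \<otimes>\<^bsub>S\<^esub> ?\<phi> \<otimes>\<^bsub>S\<^esub> ?\<phi>) s"
      using \<phi>_right[OF S_mult_closed[OF \<phi>S \<phi>S] sG] by simp
    finally have "y s = (?\<phi> \<otimes>\<^bsub>S\<^esub> ?\<phi> \<otimes>\<^bsub>S\<^esub> ?\<phi>) s" .
    then show ?thesis using \<phi>\<phi> by simp
  qed

  have y_comm: "monom b d \<otimes>\<^bsub>S\<^esub> y = y \<otimes>\<^bsub>S\<^esub> monom b d"
    if d: "d \<in> carrier G" and b: "b \<in> D d"
      and b\<phi>: "monom b d \<otimes>\<^bsub>S\<^esub> ?\<phi> = monom b d" "?\<phi> \<otimes>\<^bsub>S\<^esub> monom b d = monom b d" for b d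
  proof (rule ccontr)
    let ?m = "monom b d"
    have mS: "?m \<in> carrier S" using d b monom_closed by blast
    have bA: "b \<in> carrier A" using d b D_carrier by blast
    \<comment> \<open>The commutator of \<open>?m\<close> and \<open>y\<close> violates the
      minimality of \<open>num x\<close> unless it vanishes.\<close>
    define z where "z = ?m \<otimes>\<^bsub>S\<^esub> y \<oplus>\<^bsub>S\<^esub> \<ominus>\<^bsub>S\<^esub> (y \<otimes>\<^bsub>S\<^esub> ?m)"
    assume ne: "?m \<otimes>\<^bsub>S\<^esub> y \<noteq> y \<otimes>\<^bsub>S\<^esub> ?m"
    have z0: "z \<noteq> \<zero>\<^bsub>S\<^esub>"
    proof
      assume "z = \<zero>\<^bsub>S\<^esub>"
      then have "\<ominus>\<^bsub>S\<^esub> (\<ominus>\<^bsub>S\<^esub> (y \<otimes>\<^bsub>S\<^esub> ?m)) = ?m \<otimes>\<^bsub>S\<^esub> y"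
        using S.minus_equality mS yS by (simp add: z_def S_mult_closed)
      then show False using ne mS yS by (simp add: S_mult_closed S.minus_minus)
    qed
    have zI: "z \<in> I" unfolding z_def
      using I.rng_I_l_closed[OF yI mS] I.rng_I_r_closed[OF yI mS] by blast
    \<comment> \<open>Conjugation invariance of \<open>U\<close> puts both products into degrees in
      \<open>U\<close> times \<open>d\<close>. On the coset of \<open>d\<close> they agree: the
      \<open>N\<close>-component of \<open>y\<close> is \<open>?\<phi>\<close>, and
      \<open>?\<phi>\<close> acts as a unit on \<open>?m\<close> from both sides. So this coset
      drops out.\<close>
    have zU: "s \<otimes> inv d \<in> U - N" if s: "s \<in> support z" for s
    proof -
      have sG: "s \<in> carrier G" "z s \<noteq> \<zero>\<^bsub>A\<^esub>" using s by (auto simp: supp_def)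
      have sd: "s \<otimes> inv d \<in> carrier G" "inv d \<otimes> s \<in> carrier G" using sG d by auto
      have conj: "d \<otimes> (inv d \<otimes> s) \<otimes> inv d = s \<otimes> inv d" "inv d \<otimes> (s \<otimes> inv d) \<otimes> d = inv d \<otimes> s"
        using sG d by (simp_all add: m_assoc mult_inv_cancel)
      have zs: "z s = twist d b (y (inv d \<otimes> s)) \<oplus>\<^bsub>A\<^esub> \<ominus>\<^bsub>A\<^esub> twist (s \<otimes> inv d) (y (s \<otimes> inv d)) b"
        using sG d b yS mS by (simp add: z_def S_neg_coeff S_mult_closed monom_mult_coeff mult_monom_coeff)
      have "s \<otimes> inv d \<in> U"
      proof (rule ccontr)
        assume nU: "s \<otimes> inv d \<notin> U"
        then have "inv d \<otimes> s \<notin> U" using U_conj[of "inv d \<otimes> s" d] conj d by auto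
        then have "y (inv d \<otimes> s) = \<zero>\<^bsub>A\<^esub>" "y (s \<otimes> inv d) = \<zero>\<^bsub>A\<^esub>"
          using nU yU sd supportI by blast+
        then show False using sG zs d b bA sd by simp
      qed
      moreover have "s \<otimes> inv d \<notin> N"
      proof
        assume sN: "s \<otimes> inv d \<in> N"
        then have "inv d \<otimes> s \<in> N" using N.inv_op_closed1[OF d] conj by metis
        then have "z s = (?m \<otimes>\<^bsub>S\<^esub> ?\<phi>) s \<oplus>\<^bsub>A\<^esub> \<ominus>\<^bsub>A\<^esub> (?\<phi> \<otimes>\<^bsub>S\<^esub> ?m) s"
          unfolding zs using sN sG d b \<phi>S
          by (simp add: yN monom_mult_coeff[OF d b] mult_monom_coeff[OF d b] del: monom_coeff)
        then have "z s = ?m s \<oplus>\<^bsub>A\<^esub> \<ominus>\<^bsub>A\<^esub> ?m s" by (simp only: b\<phi>)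
        then show False using sG S_coeff_A[OF mS sG(1)] A.r_neg by simp
      qed
      ultimately show ?thesis by blast
    qed
    have "num x \<le> num z"
    proof (rule min)
      show "?P z" using zI z0 zU U_Z d by blast
    qed
    moreover have "num z < num x"
    proof -
      \<comment> \<open>Right translation by \<open>?e\<close> undoes the shift in \<open>U\<close>:
        it moves every coset met by the support of \<open>z\<close> to one met by the support of
        \<open>x\<close>. The coset of \<open>h\<close> is missed, as it could only come from that
        of \<open>d\<close>.\<close>
      let ?e = "inv d \<otimes> h"
      have eG: "?e \<in> carrier G" using d hG by simp
      have fin: "finite (support x)" "finite (support z)"
        using support_finite I.mem_carrier zI xS by auto
      \<comment> \<open>Translating back by \<open>inv ?e\<close> recovers the original cosets, so
        the translation does not lower their number.\<close>
      have "(\<lambda>s. N #> s) ` support z = (\<lambda>C. C #> inv ?e) ` (\<lambda>s. N #> (s \<otimes> ?e)) ` support z"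
      proof -
        have "N #> s = N #> (s \<otimes> ?e) #> inv ?e" if "s \<in> support z" for s
        proof -
          have "s \<in> carrier G" using that support_carrier by blast
          then show ?thesis using eG N.subset by (simp add: coset_mult_assoc m_assoc)
        qed
        then show ?thesis by (simp add: image_image cong: image_cong)
      qed
      then have "num z \<le> card ((\<lambda>s. N #> (s \<otimes> ?e)) ` support z)"
        unfolding num_def using card_image_le[of "(\<lambda>s. N #> (s \<otimes> ?e)) ` support z"] fin by simp
      also have "\<dots> \<le> card ((\<lambda>s. N #> s) ` support x - {N #> h})"
      proof (rule card_mono)
        show "(\<lambda>s. N #> (s \<otimes> ?e)) ` support z \<subseteq> (\<lambda>s. N #> s) ` support x - {N #> h}"
        proof (rule image_subsetI)
          fix s assume s: "s \<in> support z"
          then have sG: "s \<in> carrier G" using support_carrier by blast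
          have eq: "s \<otimes> ?e = s \<otimes> inv d \<otimes> h" using sG d hG by (simp add: m_assoc)
          obtain t where t: "t \<in> support x" "s \<otimes> inv d \<otimes> h \<otimes> inv t \<in> N"
            using zU[OF s] by (auto simp: U_def)
          have tG: "t \<in> carrier G" using t support_carrier by blast
          have "N #> (s \<otimes> ?e) = N #> t" using t tG sG d hG eq by (simp add: coset_iff)
          moreover have "N #> (s \<otimes> ?e) \<noteq> N #> h"
            using zU[OF s] sG d hG eq by (simp add: coset_iff m_assoc)
          ultimately show "N #> (s \<otimes> ?e) \<in> (\<lambda>s. N #> s) ` support x - {N #> h}" using t by blast
        qed
      qed (use fin in auto)
      also have "\<dots> < num x"
        unfolding num_def using fin h by (intro psubset_card_mono) auto
      finally show ?thesis .
    qed
    ultimately show False by simp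
  qed
  have y_center: "y \<in> carrier (center_ring (corner S ?\<phi>))"
  proof -
    \<comment> \<open>By additivity it suffices to compress monomials; the result is again a
      monomial fixed by \<open>?\<phi>\<close> on both sides, to which \<open>y_comm\<close>
      applies.\<close>
    have "y \<otimes>\<^bsub>S\<^esub> (?\<phi> \<otimes>\<^bsub>S\<^esub> w \<otimes>\<^bsub>S\<^esub> ?\<phi>) = (?\<phi> \<otimes>\<^bsub>S\<^esub> w \<otimes>\<^bsub>S\<^esub> ?\<phi>) \<otimes>\<^bsub>S\<^esub> y" if "w \<in> carrier S" for w
      using that
    proof (induction w rule: S_induct)
      case (monom a d)
      let ?b = "twist d (f \<otimes>\<^bsub>A\<^esub> a) f"
      have fa: "f \<otimes>\<^bsub>A\<^esub> a \<in> D d" using monom f D_mult_left by blast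
      have eq: "?\<phi> \<otimes>\<^bsub>S\<^esub> monom a d \<otimes>\<^bsub>S\<^esub> ?\<phi> = monom ?b d"
        using monom f fa D_carrier by (simp add: monom_mult_monom D_one twist_one)
      have m: "monom a d \<in> carrier S" using monom monom_closed by blast
      have "monom ?b d \<otimes>\<^bsub>S\<^esub> ?\<phi> = monom ?b d" "?\<phi> \<otimes>\<^bsub>S\<^esub> monom ?b d = monom ?b d"
        unfolding eq[symmetric] using m \<phi>S \<phi>\<phi> by (simp_all add: S_assoc S_mult_closed) (metis S_assoc S_mult_closed \<phi>\<phi>)
      then show ?case unfolding eq using y_comm[OF monom(1) twist_closed[OF monom(1) fa f(1)]] by simp
    next
      case (add v w)
      then show ?case using \<phi>S yS by (simp add: S_l_distr S_r_distr S_mult_closed)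
    qed
    moreover have "y \<in> corner_set S ?\<phi>" using y0S by (auto simp: y_def corner_set_def)
    ultimately show ?thesis by (auto simp: center_ring_def center_def corner_def corner_set_def)
  qed
  have "y \<noteq> \<zero>\<^bsub>S\<^esub>"
  proof
    assume "y = \<zero>\<^bsub>S\<^esub>"
    then have "y \<one> = \<zero>\<^bsub>A\<^esub>" by simp
    then show False using yN[OF N_one] f by simp
  qed
  then have "y \<in> Units (center_ring (corner S ?\<phi>))"
    using field.field_Units[OF fld] y_center by (simp add: center_ring_def corner_def)
  then obtain w where "w \<in> carrier (center_ring (corner S ?\<phi>))" and wy: "w \<otimes>\<^bsub>S\<^esub> y = ?\<phi>"
    by (auto simp: Units_def center_ring_def corner_def)
  then have "w \<in> corner_set S ?\<phi>" by (simp add: center_ring_def corner_def center_def)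
  then have "w \<in> carrier S" using S.corner_set_fixed[OF \<phi>S \<phi>\<phi>] by blast
  then have "?\<phi> \<in> I" using I.rng_I_l_closed[OF yI] wy by metis
  moreover have "?\<phi> \<noteq> \<zero>\<^bsub>S\<^esub>" using f by (metis S_zero_coeff monom_coeff one_closed)
  ultimately have "I = carrier S"
    using graded_simpleD[OF gs1 I _ _ one_closed] monom_support[of f \<one>] by fastforce
  then show False using I_ne by simp
qed

text \<open>Let \<open>N\<close> be maximal among the normal subgroups with
  \<open>graded_simple N\<close>. As \<open>center_mod N\<close> is again of this kind, it equals
  \<open>N\<close>, so \<open>G Mod N\<close> has trivial center and hypercentrality forces
  \<open>N = carrier G\<close>. All of \<open>G\<close> is a single coset of
  \<open>carrier G\<close>, hence every element of \<open>S\<close> is then homogeneous.\<close>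

lemma simple_if_G_simple:
  assumes G: "hypercentral G" and GA: "G_simple G A D \<alpha>"
    and f: "f \<in> carrier A" "f \<otimes>\<^bsub>A\<^esub> f = f" "f \<noteq> \<zero>\<^bsub>A\<^esub>"
    and fld: "field (center_ring (corner S (monom f \<one>)))"
  shows "simple_rng S"
proof -
  note gs1 = graded_simple_one[OF GA]
  let ?\<N> = "{N. N \<lhd> G \<and> graded_simple N}"
  obtain N where N: "N \<in> ?\<N>" and max: "\<And>M. M \<in> ?\<N> \<Longrightarrow> N \<subseteq> M \<Longrightarrow> M = N"
  proof -
    have "\<exists>N\<in>?\<N>. \<forall>M\<in>?\<N>. N \<subseteq> M \<longrightarrow> M = N"
    proof (rule subset_Zorn_nonempty)
      show "?\<N> \<noteq> {}" using gs1 one_is_normal by blast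
      fix \<C> assume C: "\<C> \<noteq> {}" "subset.chain ?\<N> \<C>"
      then have "subset.chain {N. N \<lhd> G} \<C>" by (auto simp: subset.chain_def)
      then show "\<Union>\<C> \<in> ?\<N>" using normal_Union_chain graded_simple_Union_chain C by blast
    qed
    then show ?thesis using that by blast
  qed
  interpret N: normal N G using N by blast
  have gsN: "graded_simple N" using N by blast
  have "N = carrier G"
  proof (rule ccontr)
    assume "N \<noteq> carrier G"
    then obtain g where g: "g \<in> carrier G" "g \<notin> N" using N.subset by blast
    then have "N #> g \<noteq> N" using coset_join1 N.is_subgroup by blast
    then have "carrier (G Mod N) \<noteq> {\<one>\<^bsub>G Mod N\<^esub>}" using g by (auto simp: carrier_FactGroup)
    then have "center (G Mod N) \<noteq> {\<one>\<^bsub>G Mod N\<^esub>}"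
      using G N unfolding hypercentral_def by blast
    then have "center_mod N \<noteq> N" by (rule N.center_mod_proper)
    moreover have "center_mod N \<in> ?\<N>"
      using N.center_mod_normal graded_simple_center_mod[OF _ gsN gs1 f fld] N by blast
    ultimately show False using max N.center_mod_superset by blast
  qed
  with gsN have gsG: "graded_simple (carrier G)" by simp
  show ?thesis
  proof (intro simple_rng.intro simple_rng_axioms.intro S.rng_axioms)
    have "monom f \<one> \<in> carrier S" using f by (simp add: monom_closed D_one)
    moreover have "monom f \<one> \<noteq> \<zero>\<^bsub>S\<^esub>" using f by (metis S_zero_coeff monom_coeff one_closed)
    ultimately show "carrier S \<noteq> {\<zero>\<^bsub>S\<^esub>}" by blast
    fix I assume I: "rng_ideal I S"
    interpret I: rng_ideal I S by fact
    show "I = carrier S \<or> I = {\<zero>\<^bsub>S\<^esub>}"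
    proof (cases "I = {\<zero>\<^bsub>S\<^esub>}")
      case False
      then obtain x where x: "x \<in> I" "x \<noteq> \<zero>\<^bsub>S\<^esub>" using I.zero_closed by blast
      have "I = carrier S"
        by (rule graded_simpleD[OF gsG I x one_closed]) (use support_carrier[of x] in auto)
      then show ?thesis ..
    qed simp
  qed
qed

end

theorem theorem17:
  fixes G :: "('g, 'm) monoid_scheme"
    and A :: "('a, 'n) ring_scheme"
    and D :: "'g \<Rightarrow> 'a set"
    and \<alpha> :: "'g \<Rightarrow> 'a \<Rightarrow> 'a"
    and E :: "'a set"
  assumes "hypercentral G"
    and "partial_action G A D \<alpha>"
    and "\<And>g. g \<in> carrier G \<Longrightarrow> has_local_units (A\<lparr>carrier := D g\<rparr>)"
    and "set_of_local_units A E"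
  shows "let S = skew_group_ring G A D \<alpha> in
    (simple_rng S \<longleftrightarrow>
      G_simple G A D \<alpha> \<and>
      (\<exists>f \<in> E. f \<noteq> \<zero>\<^bsub>A\<^esub> \<and> field (center_ring (corner S (skew_monom G A f \<one>\<^bsub>G\<^esub>)))))
    \<and> (simple_rng S \<longleftrightarrow>
      G_simple G A D \<alpha> \<and>
      (\<forall>f \<in> E. f \<noteq> \<zero>\<^bsub>A\<^esub> \<longrightarrow> field (center_ring (corner S (skew_monom G A f \<one>\<^bsub>G\<^esub>)))))"
proof -
  interpret locally_unital_partial_action G A D \<alpha>
    using assms(2,3) by (intro locally_unital_partial_action.intro locally_unital_partial_action_axioms.intro)
  let ?F = "\<lambda>f. field (center_ring (corner S (monom f \<one>\<^bsub>G\<^esub>)))"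
  have E: "f \<in> carrier A \<and> f \<otimes>\<^bsub>A\<^esub> f = f" if "f \<in> E" for f
    using assms(4) that by (auto simp: set_of_local_units_def)
  have all: "?F f" if simple: "simple_rng S" and f: "f \<in> E" "f \<noteq> \<zero>\<^bsub>A\<^esub>" for f
  proof (rule simple_rng.field_center_corner[OF simple])
    show "monom f \<one>\<^bsub>G\<^esub> \<in> carrier S" using E f by (simp add: monom_closed D_one)
    show "monom f \<one>\<^bsub>G\<^esub> \<otimes>\<^bsub>S\<^esub> monom f \<one>\<^bsub>G\<^esub> = monom f \<one>\<^bsub>G\<^esub>" using E f monom_one_idem by blast
    show "monom f \<one>\<^bsub>G\<^esub> \<noteq> \<zero>\<^bsub>S\<^esub>" using f by (metis S_zero_coeff monom_coeff one_closed)
  qed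
  \<comment> \<open>For the passage from all nonzero \<open>f\<close> in \<open>E\<close> to some
    such \<open>f\<close>, the set \<open>E\<close> must have a nonzero member; a local unit of a
    nonzero element of \<open>A\<close> is one.\<close>
  have nonzero: "\<exists>f\<in>E. f \<noteq> \<zero>\<^bsub>A\<^esub>" if GA: "G_simple G A D \<alpha>"
  proof -
    obtain a where a: "a \<in> carrier A" "a \<noteq> \<zero>\<^bsub>A\<^esub>" using GA A.zero_closed unfolding G_simple_def by blast
    then have "\<exists>f\<in>E. {a} \<subseteq> corner_set A f"
      using assms(4) unfolding set_of_local_units_def by (blast intro: finite.intros)
    then obtain f where f: "f \<in> E" "a \<in> corner_set A f" by blast
    then have "f \<otimes>\<^bsub>A\<^esub> a = a" using A.corner_set_fixed E by blast
    then show ?thesis using f a A.rng_zero_left by metis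
  qed
  have "simple_rng S" if "G_simple G A D \<alpha>" "f \<in> E" "f \<noteq> \<zero>\<^bsub>A\<^esub>" "?F f" for f
    using simple_if_G_simple assms(1) that E by blast
  then show ?thesis unfolding Let_def using all nonzero G_simple_if_simple by blast
qed

end
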